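(* Let $a_1,a_2:[0,\infty)\to[0,\infty)$ be continuous. Let $f_1,f_2:[0,\infty)\to[0,\infty)$ be continuous and increasing, with $f_1(0)\cdot f_2(0)\ge 0$ and $f_1(s_1)\cdot f_2(s_2)>0$ for all $s_1,s_2>0$. Let $M_1\ge\max\{1,\beta/\overline{\theta}_2(f_2(\alpha))\}$ and $M_2\ge\max\{1,\alpha/\overline{\theta}_1(f_1(\beta))\}$, and suppose there are constants $\overline{c}_1,\overline{c}_2>0$, continuous increasing functions $g_1,g_2:[0,\infty)\to[0,\infty)$ and continuous functions $\overline{\xi}_1,\overline{\xi}_2:[0,\infty)\to[0,\infty)$ such that $$f_1(t_1w_1)\le\overline{c}_1\,g_1(t_1)\,\overline{\xi}_1(w_1)\quad\text{for all } w_1\ge1,\ t_1\ge M_1\overline{\theta}_2(f_2(\alpha)),$$ $$f_2(t_2w_2)\le\overline{c}_2\,g_2(t_2)\,\overline{\xi}_2(w_2)\quad\text{for all } w_2\ge1,\ t_2\ge M_2\overline{\theta}_1(f_1(\beta)).$$ Suppose also that there are constants $\underline{c}_1,\underline{c}_2\in(0,\infty)$ and continuous functions $\underline{\xi}_1,\underline{\xi}_2:[0,\infty)\to[0,\infty)$ such that $f_1(m_1w_1)\ge\underline{c}_1\,\underline{\xi}_1(w_1)$ for all $w_1\ge1$ and $f_2(m_2w_2)\ge\underline{c}_2\,\underline{\xi}_2(w_2)$ for all $w_2\ge1$, where $m_1\in(0,\min\{\beta,\underline{\theta}_2(f_2(\alpha))\})$ and $m_2\in(0,\min\{\alpha,\underline{\theta}_1(f_1(\beta))\})$.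 If $\overline{P}_{1,2}(\infty)<H_{1,2}(\infty)<\infty$ and $\overline{P}_{2,1}(\infty)<H_{2,1}(\infty)<\infty$, then the system $$\Delta_{\phi_1}u=a_1(|x|)f_1(v),\qquad \Delta_{\phi_2}v=a_2(|x|)f_2(u),\qquad x\in\mathbb{R}^N,$$ has one positive bounded radial solution $(u,v)\in C^1([0,\infty))\times C^1([0,\infty))$ with $(u(0),v(0))=(\alpha,\beta)$ such that, for all $r\ge0$, $$\alpha+\underline{P}_{1,2}(r)\le u(r)\le H_{1,2}^{-1}\big(\overline{k}_1\overline{P}_{1,2}(r)\big),\qquad \beta+\underline{P}_{2,1}(r)\le v(r)\le H_{2,1}^{-1}\big(\overline{k}_2\overline{P}_{2,1}(r)\big).$$
   Context: Standing setting. $N\ge3$ is an integer and $\alpha,\beta\in(0,\infty)$ are arbitrary parameters. $\Delta_{\phi_i}u:=\operatorname{div}(\phi_i(|\nabla u|)\nabla u)$, $i=1,2$, where: - $\phi_i\in C^1((0,\infty),(0,\infty))$ and $\lim_{t\to0}t\phi_i(t)=0$; - $t\phi_i(t)>0$ is strictly increasing for $t>0$; - $h_i^{-1}$ is the inverse function of $h_i(t)=t\phi_i(t)$, $t>0$ (with $h_i^{-1}(0)=0$), and there exist constants $\underline{k}_i,\overline{k}_i>0$, continuous increasing functions $\underline{\theta}_i,\overline{\theta}_i:[0,\infty)\to[0,\infty)$ and continuous functions $\underline{\psi}_i,\overline{\psi}_i:[0,\infty)\to[0,\infty)$ (all fixed) such that $\underline{k}_i\underline{\theta}_i(s_1)\underline{\psi}_i(s_2)\le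 h_i^{-1}(s_1s_2)\le\overline{k}_i\overline{\theta}_i(s_1)\overline{\psi}_i(s_2)$ for all $s_1,s_2>0$. A radial solution is a pair of functions of $r=|x|$; radial solutions correspond to solutions on $[0,\infty)$ of $(r^{N-1}\phi_1(|u'|)u')'=r^{N-1}a_1(r)f_1(v)$, $(r^{N-1}\phi_2(|v'|)v')'=r^{N-1}a_2(r)f_2(u)$ with $u'(0)=v'(0)=0$. Notation, in terms of the data in the claim: $$\overline{\mathcal{A}}_{a_i}(t)=\int_0^t\overline{k}_i\overline{\psi}_i\Big(s^{1-N}\int_0^sz^{N-1}a_i(z)dz\Big)ds,\qquad \underline{\mathcal{A}}_{a_i}(t)=\int_0^t\underline{k}_i\underline{\psi}_i\Big(s^{1-N}\int_0^sz^{N-1}a_i(z)dz\Big)ds,$$ $$\overline{P}_{1,2}(r)=\int_0^r\overline{\psi}_1\Big(\overline{c}_1y^{1-N}\int_0^yt^{N-1}a_1(t)\overline{\xi}_1(1+\overline{\mathcal{A}}_{a_2}(t))dt\Big)dy,$$ $$\overline{P}_{2,1}(r)=\int_0^r\overline{\psi}_2\Big(\overline{c}_2y^{1-N}\int_0^yt^{N-1}a_2(t)\overline{\xi}_2(1+\overline{\mathcal{A}}_{a_1}(t))dt\Big)dy,$$ $$\underline{P}_{1,2}(r)=\int_0^rh_1^{-1}\Big(\underline{c}_1y^{1-N}\int_0^yt^{N-1}a_1(t)\underline{\xi}_1(1+\underline{\mathcal{A}}_{a_2}(t))dt\Big)dy,$$ $$\underline{P}_{2,1}(r)=\int_0^rh_2^{-1}\Big(\underline{c}_2y^{1-N}\int_0^yt^{N-1}a_2(t)\underline{\xi}_2(1+\underline{\mathcal{A}}_{a_1}(t))dt\Big)dy,$$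 $$H_{1,2}(r)=\int_\alpha^r\frac{dt}{\overline{\theta}_1(g_1(M_1\overline{\theta}_2(f_2(t))))},\qquad H_{2,1}(r)=\int_\beta^r\frac{dt}{\overline{\theta}_2(g_2(M_2\overline{\theta}_1(f_1(t))))},$$ and for each of these functions $F$, $F(\infty):=\lim_{r\to\infty}F(r)$. $H_{1,2}$ and $H_{2,1}$ are strictly increasing, with inverse functions $H_{1,2}^{-1}$ on $[0,H_{1,2}(\infty))$ and $H_{2,1}^{-1}$ on $[0,H_{2,1}(\infty))$.
   Formalization: The formal theorem also assumes k̄₁P̄₁,₂(r)<H₁,₂(∞) and k̄₂P̄₂,₁(r)<H₂,₁(∞) for every r≥0, so that the upper bounds are defined; without this the claim fails when k̄ᵢ is large (φᵢ=1, fᵢ=t³, blow-up at a finite radius). *)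

theory Defs
  imports "HOL-Analysis.Analysis"
begin

text \<open>Functions on $[0,\infty)$ are total functions on the reals whose values at negative
  arguments are never used. ``Increasing'' is read in the weak sense.\<close>

definition cont_nonneg :: "(real \<Rightarrow> real) \<Rightarrow> bool" where
  "cont_nonneg f \<longleftrightarrow> continuous_on {0..} f \<and> (\<forall>t\<ge>0. 0 \<le> f t)"

definition cont_nonneg_incr :: "(real \<Rightarrow> real) \<Rightarrow> bool" where
  "cont_nonneg_incr f \<longleftrightarrow> cont_nonneg f \<and> mono_on {0..} f"


subsection \<open>The operators\<close>

definition h_fun :: "(real \<Rightarrow> real) \<Rightarrow> real \<Rightarrow> real" where
  "h_fun \<phi> t = t * \<phi> t"

definition h_inv :: "(real \<Rightarrow> real) \<Rightarrow> real \<Rightarrow> real" where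
  "h_inv \<phi> s = (if s = 0 then 0 else the_inv_into {0<..} (h_fun \<phi>) s)"

text \<open>The condition \<open>{0<..} \<subseteq> h_fun \<phi> ` {0<..}\<close> makes explicit that the inverse of
  $h(t) = t\phi(t)$ is defined at every $s_1 s_2$ with $s_1, s_2 > 0$, as the two-sided
  estimate presupposes.\<close>

definition admissible_phi ::
  "(real \<Rightarrow> real) \<Rightarrow> real \<Rightarrow> real \<Rightarrow> (real \<Rightarrow> real) \<Rightarrow> (real \<Rightarrow> real) \<Rightarrow>
   (real \<Rightarrow> real) \<Rightarrow> (real \<Rightarrow> real) \<Rightarrow> bool" where
  "admissible_phi \<phi> k_lo k_up \<theta>_lo \<theta>_up \<psi>_lo \<psi>_up \<longleftrightarrow>
     \<phi> C1_differentiable_on {0<..} \<and> (\<forall>t>0. 0 < \<phi> t) \<and>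
     (h_fun \<phi> \<longlongrightarrow> 0) (at_right 0) \<and>
     strict_mono_on {0<..} (h_fun \<phi>) \<and>
     {0<..} \<subseteq> h_fun \<phi> ` {0<..} \<and>
     0 < k_lo \<and> 0 < k_up \<and>
     cont_nonneg_incr \<theta>_lo \<and> cont_nonneg_incr \<theta>_up \<and>
     cont_nonneg \<psi>_lo \<and> cont_nonneg \<psi>_up \<and>
     (\<forall>s1>0. \<forall>s2>0. k_lo * \<theta>_lo s1 * \<psi>_lo s2 \<le> h_inv \<phi> (s1 * s2) \<and>
                       h_inv \<phi> (s1 * s2) \<le> k_up * \<theta>_up s1 * \<psi>_up s2)"

definition has_divergence ::
  "('a::euclidean_space \<Rightarrow> 'a) \<Rightarrow> real \<Rightarrow> 'a \<Rightarrow> bool" where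
  "has_divergence F d x \<longleftrightarrow>
     (\<exists>F'. (F has_derivative F') (at x) \<and> d = (\<Sum>b\<in>Basis. F' b \<bullet> b))"

text \<open>$\operatorname{div}(\phi(|\nabla U|)\nabla U) = R$ at every point of the whole space, in the
  classical sense. Where the gradient \<open>G y\<close> vanishes the flux is 0 whatever \<open>\<phi> 0\<close> is, which
  is its continuous extension because $t\phi(t) \to 0$ as $t \to 0$.\<close>

definition phi_laplacian_eq ::
  "(real \<Rightarrow> real) \<Rightarrow> ('a::euclidean_space \<Rightarrow> real) \<Rightarrow> ('a \<Rightarrow> real) \<Rightarrow> bool" where
  "phi_laplacian_eq \<phi> U R \<longleftrightarrow>
     (\<exists>G. (\<forall>x. GDERIV U x :> G x) \<and>
          (\<forall>x. has_divergence (\<lambda>y. \<phi> (norm (G y)) *\<^sub>R G y) (R x) x))"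


subsection \<open>Radial solutions\<close>

text \<open>$u \in C^1([0,\infty))$ with derivative \<open>u'\<close>, one-sided at 0.\<close>

definition C1_halfline :: "(real \<Rightarrow> real) \<Rightarrow> (real \<Rightarrow> real) \<Rightarrow> bool" where
  "C1_halfline u u' \<longleftrightarrow>
     (\<forall>r\<ge>0. (u has_real_derivative u' r) (at r within {0..})) \<and> continuous_on {0..} u'"

text \<open>$(r^{N-1}\phi(|u'|)u')' = r^{N-1} R(r)$ on $[0,\infty)$.\<close>

definition radial_eq ::
  "nat \<Rightarrow> (real \<Rightarrow> real) \<Rightarrow> (real \<Rightarrow> real) \<Rightarrow> (real \<Rightarrow> real) \<Rightarrow> bool" where
  "radial_eq N \<phi> u' R \<longleftrightarrow>
     (\<forall>r\<ge>0. ((\<lambda>s. s ^ (N - 1) * (\<phi> \<bar>u' s\<bar> * u' s))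
               has_real_derivative r ^ (N - 1) * R r) (at r within {0..}))"

text \<open>The type argument carries the space on which the system is posed; its dimension plays the
  role of $N$. Both the system on the whole space, for $u(|x|)$ and $v(|x|)$, and the
  corresponding system on the half-line are required.\<close>

definition radial_solution ::
  "'a::euclidean_space itself \<Rightarrow> (real \<Rightarrow> real) \<Rightarrow> (real \<Rightarrow> real) \<Rightarrow>
   (real \<Rightarrow> real) \<Rightarrow> (real \<Rightarrow> real) \<Rightarrow> (real \<Rightarrow> real) \<Rightarrow> (real \<Rightarrow> real) \<Rightarrow>
   (real \<Rightarrow> real) \<Rightarrow> (real \<Rightarrow> real) \<Rightarrow> bool" where
  "radial_solution TYPE('a) \<phi>1 \<phi>2 a1 a2 f1 f2 u v \<longleftrightarrow>
     phi_laplacian_eq \<phi>1 (\<lambda>x::'a. u (norm x)) (\<lambda>x. a1 (norm x) * f1 (v (norm x))) \<and>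
     phi_laplacian_eq \<phi>2 (\<lambda>x::'a. v (norm x)) (\<lambda>x. a2 (norm x) * f2 (u (norm x))) \<and>
     (\<exists>u' v'. C1_halfline u u' \<and> C1_halfline v v' \<and> u' 0 = 0 \<and> v' 0 = 0 \<and>
        radial_eq DIM('a) \<phi>1 u' (\<lambda>r. a1 r * f1 (v r)) \<and>
        radial_eq DIM('a) \<phi>2 v' (\<lambda>r. a2 r * f2 (u r)))"


subsection \<open>The auxiliary functions\<close>

text \<open>$s^{1-N}\int_0^s z^{N-1} b(z)\,dz$\<close>

definition radial_avg :: "nat \<Rightarrow> (real \<Rightarrow> real) \<Rightarrow> real \<Rightarrow> real" where
  "radial_avg N b s = s powr (1 - real N) * integral {0..s} (\<lambda>z. z ^ (N - 1) * b z)"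

definition A_fun ::
  "nat \<Rightarrow> real \<Rightarrow> (real \<Rightarrow> real) \<Rightarrow> (real \<Rightarrow> real) \<Rightarrow> real \<Rightarrow> real" where
  "A_fun N k \<psi> a t = integral {0..t} (\<lambda>s. k * \<psi> (radial_avg N a s))"

text \<open>The upper functions $\overline{P}$ are obtained with \<open>\<omega>\<close> the function $\overline{\psi}_i$, the lower
  functions $\underline{P}$ with \<open>\<omega> = h_inv \<phi>\<^sub>i\<close>.\<close>

definition P_fun ::
  "nat \<Rightarrow> (real \<Rightarrow> real) \<Rightarrow> real \<Rightarrow> (real \<Rightarrow> real) \<Rightarrow> (real \<Rightarrow> real) \<Rightarrow> (real \<Rightarrow> real) \<Rightarrow>
   real \<Rightarrow> real" where
  "P_fun N \<omega> c a \<xi> A r =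
     integral {0..r} (\<lambda>y. \<omega> (c * radial_avg N (\<lambda>t. a t * \<xi> (1 + A t)) y))"

definition H_fun ::
  "real \<Rightarrow> (real \<Rightarrow> real) \<Rightarrow> (real \<Rightarrow> real) \<Rightarrow> real \<Rightarrow> (real \<Rightarrow> real) \<Rightarrow> (real \<Rightarrow> real) \<Rightarrow>
   real \<Rightarrow> real" where
  "H_fun \<gamma> \<theta> g M \<theta>' f r = integral {\<gamma>..r} (\<lambda>t. 1 / \<theta> (g (M * \<theta>' (f t))))"

definition at_infty :: "(real \<Rightarrow> real) \<Rightarrow> ereal" where
  "at_infty F = Lim at_top (\<lambda>r. ereal (F r))"

end

theory Submission
  imports Defs
begin

text \<open>Integrating the radial equations twice turns the system into a fixed point problem: \<open>u\<close> is
  \<open>\<alpha>\<close> plus the integral of \<open>h_inv \<phi>1\<close> applied to the radial average of \<open>a1 * f1 (v)\<close>, and \<open>v\<close> is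
  obtained in the same way from \<open>u\<close>. Because \<open>h_inv \<phi>i\<close> and \<open>fi\<close> increase, both operators are
  monotone. The iteration that starts from the constants \<open>\<alpha>\<close> and \<open>\<beta>\<close> therefore increases, and it
  converges as soon as the iterates stay below a barrier; dominated convergence lets the limit solve
  the integral equations (\<open>coupled_solution_exists\<close>). A solution of the integral equations is a
  classical radial solution on the whole space, the only delicate point being the origin
  (\<open>phi_laplacian_radial_profile\<close>).

  The barrier comes from a Keller-Osserman argument. Since \<open>u\<close> is nondecreasing, \<open>f2 (u)\<close> can be
  taken out of the average at its last value, so the second equation gives
  \<open>v \<le> M1 * \<theta>up2 (f2 u) * (1 + A)\<close> with \<open>A = Aup2\<close>. The splitting of \<open>f1\<close> then separates the
  variables: with \<open>G u = g1 (M1 * \<theta>up2 (f2 u))\<close> one has \<open>u' / \<theta>up1 (G u) \<le> kup1 * P'\<close> for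
  \<open>P = Pup12\<close>, and integration yields \<open>H12 (u) \<le> kup1 * P\<close>. Two successive iterates satisfy one
  equation exactly and the other as an inequality, and this is all the argument uses
  (\<open>subsolution_pair\<close>). The lower bounds follow from \<open>u \<ge> \<alpha>\<close> and \<open>v \<ge> \<beta>\<close> by inserting them once into
  the equations (\<open>component_lower_bound\<close>).

  Boundedness is more than the upper bound says, because the values \<open>kup1 * P r\<close> may approach
  \<open>H12(\<infinity>)\<close> itself. It holds because the differential inequality is strict somewhere if \<open>u\<close> is
  unbounded: as \<open>H12(\<infinity>)\<close> is finite, \<open>G\<close> cannot be constant, hence \<open>G (u t) < G (u r)\<close> for
  some \<open>t < r\<close> with \<open>a1 t > 0\<close>, and replacing the former by the latter in the average loses a positive
  amount. From \<open>r\<close> on, \<open>H12 (u)\<close> then stays a fixed distance below \<open>H12(\<infinity>)\<close>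
  (\<open>bounded_above\<close>).\<close>

section \<open>Integrals over initial segments of a half-line\<close>

lemma halfline_integrable:
  fixes g :: "real \<Rightarrow> real"
  assumes "continuous_on {c..} g"
  shows "g integrable_on {c..x}"
  by (rule integrable_continuous_interval) (rule continuous_on_subset[OF assms], auto)

lemma halfline_integral_deriv:
  fixes g :: "real \<Rightarrow> real"
  assumes g: "continuous_on {c..} g" and r: "c \<le> r"
  shows "((\<lambda>x. integral {c..x} g) has_real_derivative g r) (at r within {c..})"
proof -
  have "at r within {c..r+1} = at r within {c..}"
    by (rule at_within_nhd[of r "{..<r+1}"]) auto
  moreover have "((\<lambda>x. integral {c..x} g) has_real_derivative g r) (at r within {c..r+1})"
    by (rule integral_has_real_derivative) (use r in \<open>auto intro: continuous_on_subset[OF g]\<close>)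
  ultimately show ?thesis by simp
qed

lemma halfline_integral_deriv_interior:
  fixes g :: "real \<Rightarrow> real"
  assumes g: "continuous_on {c..} g" and r: "c < r"
  shows "((\<lambda>x. integral {c..x} g) has_real_derivative g r) (at r)"
proof -
  have "at r within {c..} = at r" by (rule at_within_interior) (use r in auto)
  then show ?thesis using halfline_integral_deriv[OF g, of r] r by simp
qed

lemma halfline_integral_continuous:
  fixes g :: "real \<Rightarrow> real"
  assumes g: "continuous_on {c..} g"
  shows "continuous_on {c..} (\<lambda>x. integral {c..x} g)"
  by (rule DERIV_continuous_on) (rule halfline_integral_deriv[OF g], simp)

section \<open>Radial averages\<close>

lemma radial_avg_0 [simp]: "radial_avg N b 0 = 0"
  by (simp add: radial_avg_def)

lemma radial_avg_eq_divide:
  assumes "1 \<le> N" "0 \<le> s"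
  shows "radial_avg N b s = integral {0..s} (\<lambda>z. z ^ (N - 1) * b z) / s ^ (N - 1)"
proof (cases "s = 0")
  case False
  then have "s powr (1 - real N) = inverse (s ^ (N - 1))"
    using assms powr_minus[of s "real (N - 1)"] powr_realpow[of s "N - 1"] by (simp add: of_nat_diff)
  then show ?thesis by (simp add: radial_avg_def field_simps)
qed (simp add: radial_avg_def)

lemma radial_integrand_continuous:
  "continuous_on {0..} b \<Longrightarrow> continuous_on {0..} (\<lambda>z::real. z ^ (N - 1) * b z)"
  by (intro continuous_intros)

lemma radial_avg_cmult: "radial_avg N (\<lambda>t. k * b t) s = k * radial_avg N b s"
proof -
  have "(\<lambda>z. z ^ (N - 1) * (k * b z)) = (\<lambda>z. k * (z ^ (N - 1) * b z))"
    by (simp add: mult_ac)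
  then show ?thesis by (simp add: radial_avg_def)
qed

lemma radial_avg_diff:
  assumes "continuous_on {0..} b" "continuous_on {0..} c"
  shows "radial_avg N (\<lambda>t. b t - c t) s = radial_avg N b s - radial_avg N c s"
proof -
  have "integral {0..s} (\<lambda>z. z ^ (N - 1) * b z - z ^ (N - 1) * c z) =
      integral {0..s} (\<lambda>z. z ^ (N - 1) * b z) - integral {0..s} (\<lambda>z. z ^ (N - 1) * c z)"
    by (intro integral_diff halfline_integrable radial_integrand_continuous assms)
  then show ?thesis by (simp add: radial_avg_def right_diff_distrib)
qed

lemma radial_avg_mono:
  assumes "continuous_on {0..} b" "continuous_on {0..} c"
    and "\<And>t. 0 \<le> t \<Longrightarrow> t \<le> s \<Longrightarrow> b t \<le> c t"
  shows "radial_avg N b s \<le> radial_avg N c s"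
  unfolding radial_avg_def
  by (intro mult_left_mono integral_le halfline_integrable radial_integrand_continuous)
     (use assms in \<open>auto intro!: mult_left_mono\<close>)

lemma radial_avg_nonneg:
  assumes "continuous_on {0..} b" and "\<And>t. 0 \<le> t \<Longrightarrow> 0 \<le> b t"
  shows "0 \<le> radial_avg N b s"
  unfolding radial_avg_def
  by (intro mult_nonneg_nonneg integral_nonneg halfline_integrable radial_integrand_continuous)
     (use assms in auto)

text \<open>A single point where the integrand is positive makes the whole average positive, by
  continuity; this is what turns a weak estimate into a strict one.\<close>

lemma radial_avg_pos:
  assumes N: "1 \<le> N" and b: "continuous_on {0..} b" and nn: "\<And>t. 0 \<le> t \<Longrightarrow> t \<le> s \<Longrightarrow> 0 \<le> b t"
    and t: "0 < t" "t \<le> s" "0 < b t"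
  shows "0 < radial_avg N b s"
proof -
  let ?g = "\<lambda>z. z ^ (N - 1) * b z"
  have g: "continuous_on {0..s} ?g"
    by (rule continuous_on_subset[OF radial_integrand_continuous[OF b]]) auto
  have "integral {0..s} ?g \<noteq> 0"
  proof
    assume "integral {0..s} ?g = 0"
    then have "\<forall>x\<in>{0..s}. ?g x = 0"
      using integral_eq_0_iff[OF g] t nn by auto
    then have "?g t = 0" by (rule bspec) (use t in simp)
    then show False using t by simp
  qed
  moreover have "0 \<le> integral {0..s} ?g"
    by (rule integral_nonneg) (use integrable_continuous_interval[OF g] nn in auto)
  ultimately show ?thesis
    using N t by (simp add: radial_avg_eq_divide)
qed

text \<open>By l'Hospital's rule. This one limit yields both the continuity of the average at 0 and the
  value of the divergence at the origin.\<close>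

lemma radial_avg_ratio_tendsto:
  assumes N: "1 \<le> N" and b: "continuous_on {0..} b"
  shows "((\<lambda>s. radial_avg N b s / s) \<longlongrightarrow> b 0 / real N) (at_right 0)"
proof -
  let ?g = "\<lambda>z. z ^ (N - 1) * b z"
  let ?I = "\<lambda>s. integral {0..s} ?g"
  have g: "continuous_on {0..} ?g" by (rule radial_integrand_continuous[OF b])
  have right: "at_right (0::real) \<le> at 0 within {0..}"
    by (rule at_le) auto
  have pos: "\<forall>\<^sub>F s in at_right (0::real). 0 < s"
    by (simp add: eventually_at_filter)
  have "((\<lambda>s. ?I s / s ^ N) \<longlongrightarrow> b 0 / real N) (at_right 0)"
  proof (rule lhopital_right_0[where f' = ?g and g' = "\<lambda>s. real N * s ^ (N - 1)"])
    have "(?I \<longlongrightarrow> ?I 0) (at 0 within {0..})"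
      using halfline_integral_continuous[OF g] unfolding continuous_on_def by (rule bspec) simp
    from tendsto_mono[OF right this] show "(?I \<longlongrightarrow> 0) (at_right 0)" by simp
    show "((\<lambda>s::real. s ^ N) \<longlongrightarrow> 0) (at_right 0)"
      using N by (auto intro!: tendsto_eq_intros simp: power_0_left)
    show "\<forall>\<^sub>F s::real in at_right 0. s ^ N \<noteq> 0"
      by (rule eventually_mono[OF pos]) auto
    show "\<forall>\<^sub>F s::real in at_right 0. real N * s ^ (N - 1) \<noteq> 0"
      by (rule eventually_mono[OF pos]) (use N in auto)
    show "\<forall>\<^sub>F s in at_right 0. (?I has_real_derivative ?g s) (at s)"
      by (rule eventually_mono[OF pos]) (rule halfline_integral_deriv_interior[OF g])
    show "\<forall>\<^sub>F s::real in at_right 0. ((\<lambda>s. s ^ N) has_real_derivative real N * s ^ (N - 1)) (at s)"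
      by (rule eventually_mono[OF pos]) (auto intro!: derivative_eq_intros)
    have "(b \<longlongrightarrow> b 0) (at_right 0)"
      by (rule tendsto_mono[OF right]) (use b in \<open>simp add: continuous_on_def\<close>)
    then have "((\<lambda>s. b s / real N) \<longlongrightarrow> b 0 / real N) (at_right 0)"
      by (intro tendsto_intros) (use N in auto)
    moreover have "\<forall>\<^sub>F s in at_right 0. b s / real N = ?g s / (real N * s ^ (N - 1))"
      by (rule eventually_mono[OF pos]) (use N in auto)
    ultimately show "((\<lambda>s. ?g s / (real N * s ^ (N - 1))) \<longlongrightarrow> b 0 / real N) (at_right 0)"
      by (rule Lim_transform_eventually)
  qed
  moreover have "\<forall>\<^sub>F s in at_right 0. ?I s / s ^ N = radial_avg N b s / s"
  proof (rule eventually_mono[OF pos])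
    fix s :: real assume "0 < s"
    moreover obtain m where "N = Suc m" using N by (cases N) auto
    ultimately show "?I s / s ^ N = radial_avg N b s / s"
      by (simp add: radial_avg_eq_divide mult.commute)
  qed
  ultimately show ?thesis by (rule Lim_transform_eventually)
qed

lemma radial_avg_continuous:
  assumes N: "1 \<le> N" and b: "continuous_on {0..} b"
  shows "continuous_on {0..} (radial_avg N b)"
  unfolding continuous_on_def
proof
  fix s :: real assume "s \<in> {0..}"
  show "(radial_avg N b \<longlongrightarrow> radial_avg N b s) (at s within {0..})"
  proof (cases "s = 0")
    case True
    have pos: "\<forall>\<^sub>F s in at_right (0::real). 0 < s"
      by (simp add: eventually_at_filter)
    have "((\<lambda>s. radial_avg N b s / s * s) \<longlongrightarrow> b 0 / real N * 0) (at_right 0)"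
      by (intro tendsto_mult radial_avg_ratio_tendsto[OF N b] tendsto_ident_at)
    moreover have "\<forall>\<^sub>F s in at_right 0. radial_avg N b s / s * s = radial_avg N b s"
      by (rule eventually_mono[OF pos]) simp
    ultimately have "(radial_avg N b \<longlongrightarrow> b 0 / real N * 0) (at_right 0)"
      by (rule Lim_transform_eventually)
    then have "(radial_avg N b \<longlongrightarrow> 0) (at_right 0)" by simp
    moreover have "at 0 within {0..} = at_right (0::real)"
      by (simp add: at_within_def) (rule arg_cong[where f = "\<lambda>S. inf (nhds 0) (principal S)"], auto)
    ultimately show ?thesis using True by simp
  next
    case False
    with \<open>s \<in> {0..}\<close> have s: "0 < s" by simp
    have "continuous_on {0<..} (\<lambda>s. integral {0..s} (\<lambda>z. z ^ (N - 1) * b z) / s ^ (N - 1))"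
      by (intro continuous_intros
            continuous_on_subset[OF halfline_integral_continuous[OF radial_integrand_continuous[OF b]]])
         auto
    then have "continuous_on {0<..} (radial_avg N b)"
      by (rule continuous_on_eq) (use N in \<open>simp add: radial_avg_eq_divide\<close>)
    then have "isCont (radial_avg N b) s"
      using s by (simp add: continuous_on_eq_continuous_at)
    then show ?thesis by (simp add: isCont_def Lim_at_imp_Lim_at_within)
  qed
qed

section \<open>Solving the radial equation by quadrature\<close>

text \<open>The properties of \<open>h_inv \<phi>\<close> on which existence and monotonicity of the profiles rest; the
  two-sided estimate enters only later, through the bounds.\<close>

definition gauge_fun :: "(real \<Rightarrow> real) \<Rightarrow> bool" where
  "gauge_fun h \<longleftrightarrow> continuous_on {0..} h \<and> strict_mono_on {0..} h \<and> h 0 = 0"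

lemma gauge_fun_less: "gauge_fun h \<Longrightarrow> 0 \<le> x \<Longrightarrow> x < y \<Longrightarrow> h x < h y"
  by (auto simp: gauge_fun_def strict_mono_on_def)

lemma gauge_fun_le: "gauge_fun h \<Longrightarrow> 0 \<le> x \<Longrightarrow> x \<le> y \<Longrightarrow> h x \<le> h y"
  using gauge_fun_less[of h x y] by (cases "x = y") auto

lemma gauge_fun_nonneg: "gauge_fun h \<Longrightarrow> 0 \<le> x \<Longrightarrow> 0 \<le> h x"
  using gauge_fun_le[of h 0 x] by (simp add: gauge_fun_def)

lemma h_inv_right_inverse:
  assumes "admissible_phi \<phi> k_lo k_up \<theta>_lo \<theta>_up \<psi>_lo \<psi>_up" and "0 < s"
  shows "0 < h_inv \<phi> s" and "h_fun \<phi> (h_inv \<phi> s) = s"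
proof -
  have inj: "inj_on (h_fun \<phi>) {0<..}" and s: "s \<in> h_fun \<phi> ` {0<..}"
    using assms by (auto simp: admissible_phi_def intro: strict_mono_on_imp_inj_on)
  show "0 < h_inv \<phi> s"
    using the_inv_into_into[OF inj s, of "{0<..}"] assms by (simp add: h_inv_def)
  show "h_fun \<phi> (h_inv \<phi> s) = s"
    using f_the_inv_into_f[OF inj s] assms by (simp add: h_inv_def)
qed

text \<open>An increasing function whose range is an interval without gaps is continuous. Continuing
  \<open>h_inv \<phi>\<close> by the identity to the negative axis makes the range the whole line, so that the
  origin needs no separate treatment.\<close>

lemma gauge_fun_h_inv:
  assumes adm: "admissible_phi \<phi> k_lo k_up \<theta>_lo \<theta>_up \<psi>_lo \<psi>_up"
  shows "gauge_fun (h_inv \<phi>)"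
proof -
  note inv = h_inv_right_inverse[OF adm]
  have sm: "strict_mono_on {0<..} (h_fun \<phi>)" and pos: "\<And>t. 0 < t \<Longrightarrow> 0 < h_fun \<phi> t"
    using adm by (auto simp: admissible_phi_def h_fun_def)
  have left: "h_inv \<phi> (h_fun \<phi> t) = t" if "0 < t" for t
    using the_inv_into_f_f[OF strict_mono_on_imp_inj_on[OF sm], of t] pos[OF that] that
    by (auto simp: h_inv_def)
  have less: "h_inv \<phi> x < h_inv \<phi> y" if "0 < x" "x < y" for x y
  proof (rule ccontr)
    assume "\<not> h_inv \<phi> x < h_inv \<phi> y"
    then have "h_fun \<phi> (h_inv \<phi> y) \<le> h_fun \<phi> (h_inv \<phi> x)"
      using sm inv(1)[of x] inv(1)[of y] that
      by (cases "h_inv \<phi> x = h_inv \<phi> y") (auto simp: strict_mono_on_def intro: less_imp_le)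
    then show False using inv(2)[of x] inv(2)[of y] that by simp
  qed
  have zero: "h_inv \<phi> 0 = 0" by (simp add: h_inv_def)
  define k where "k = (\<lambda>s. if s \<le> 0 then s else h_inv \<phi> s)"
  have "y \<in> range k" for y
  proof (cases "y \<le> 0")
    case True then show ?thesis by (auto simp: k_def intro!: image_eqI[of _ _ y])
  next
    case False
    then show ?thesis using left[of y] pos[of y]
      by (auto simp: k_def intro!: image_eqI[of _ _ "h_fun \<phi> y"])
  qed
  then have "range k = UNIV" by auto
  then have "continuous_on UNIV k"
  proof (intro continuous_onI_mono)
    fix x y :: real assume "x \<le> y"
    then show "k x \<le> k y"
      using less[of x y] inv(1)[of y] by (cases "x = y") (auto simp: k_def)
  qed simp
  then have "continuous_on {0..} k" by (rule continuous_on_subset) simp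
  then have "continuous_on {0..} (h_inv \<phi>)"
    by (rule continuous_on_eq) (auto simp: k_def zero)
  moreover have "strict_mono_on {0..} (h_inv \<phi>)"
  proof (rule strict_mono_onI)
    fix x y :: real assume "x \<in> {0..}" "y \<in> {0..}" "x < y"
    then show "h_inv \<phi> x < h_inv \<phi> y"
      using less[of x y] inv(1)[of y] zero by (cases "x = 0") auto
  qed
  ultimately show ?thesis using zero by (simp add: gauge_fun_def)
qed

text \<open>For \<open>h = h_inv \<phi>\<close> this is the solution of the radial equation with right-hand side \<open>b\<close>,
  initial value \<open>\<gamma>\<close> and vanishing initial slope: one integration gives the flux, inverting
  \<open>h_fun \<phi>\<close> gives the slope, a second integration gives the function. With \<open>h\<close> one of the
  functions \<open>\<psi>\<close> it describes the comparison functions \<open>P_fun\<close> as well.\<close>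

definition radial_profile ::
  "nat \<Rightarrow> (real \<Rightarrow> real) \<Rightarrow> real \<Rightarrow> (real \<Rightarrow> real) \<Rightarrow> real \<Rightarrow> real" where
  "radial_profile N h \<gamma> b r = \<gamma> + integral {0..r} (\<lambda>s. h (radial_avg N b s))"

lemma radial_profile_0 [simp]: "radial_profile N h \<gamma> b 0 = \<gamma>"
  by (simp add: radial_profile_def)

lemma gauge_radial_avg_continuous:
  assumes "1 \<le> N" "continuous_on {0..} h" and b: "cont_nonneg b"
  shows "continuous_on {0..} (\<lambda>s. h (radial_avg N b s))"
proof (rule continuous_on_compose2[OF assms(2)])
  show "continuous_on {0..} (radial_avg N b)"
    by (rule radial_avg_continuous[OF assms(1)]) (use b in \<open>simp add: cont_nonneg_def\<close>)
  show "radial_avg N b ` {0..} \<subseteq> {0..}"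
    using radial_avg_nonneg[of b N] b by (auto simp: cont_nonneg_def)
qed

lemma radial_profile_deriv:
  assumes "1 \<le> N" "continuous_on {0..} h" "cont_nonneg b" "0 \<le> r"
  shows "(radial_profile N h \<gamma> b has_real_derivative h (radial_avg N b r)) (at r within {0..})"
  using DERIV_add[OF DERIV_const
      halfline_integral_deriv[OF gauge_radial_avg_continuous[OF assms(1-3)] assms(4)]]
  by (simp add: radial_profile_def[abs_def])

lemma radial_profile_continuous:
  assumes "1 \<le> N" "continuous_on {0..} h" "cont_nonneg b"
  shows "continuous_on {0..} (radial_profile N h \<gamma> b)"
  by (rule DERIV_continuous_on) (rule radial_profile_deriv[OF assms], simp)

lemma radial_profile_mono:
  assumes N: "1 \<le> N" and h: "gauge_fun h" and b: "cont_nonneg b" and c: "cont_nonneg c"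
    and le: "\<And>t. 0 \<le> t \<Longrightarrow> t \<le> r \<Longrightarrow> b t \<le> c t"
  shows "radial_profile N h \<gamma> b r \<le> radial_profile N h \<gamma> c r"
proof -
  have hc: "continuous_on {0..} h" using h by (simp add: gauge_fun_def)
  have "integral {0..r} (\<lambda>s. h (radial_avg N b s)) \<le> integral {0..r} (\<lambda>s. h (radial_avg N c s))"
  proof (intro integral_le halfline_integrable gauge_radial_avg_continuous N hc b c)
    fix s assume "s \<in> {0..r}"
    then show "h (radial_avg N b s) \<le> h (radial_avg N c s)"
      using b c le by (intro gauge_fun_le[OF h] radial_avg_mono radial_avg_nonneg)
        (auto simp: cont_nonneg_def)
  qed
  then show ?thesis by (simp add: radial_profile_def)
qed

lemma radial_profile_incr:
  assumes N: "1 \<le> N" and h: "gauge_fun h" and b: "cont_nonneg b"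
    and rs: "0 \<le> r" "r \<le> s"
  shows "radial_profile N h \<gamma> b r \<le> radial_profile N h \<gamma> b s"
proof -
  have hc: "continuous_on {0..} h" using h by (simp add: gauge_fun_def)
  have "integral {0..r} (\<lambda>s. h (radial_avg N b s)) \<le> integral {0..s} (\<lambda>s. h (radial_avg N b s))"
  proof (intro integral_subset_le halfline_integrable gauge_radial_avg_continuous N hc b ballI)
    fix x assume "x \<in> {0..s}"
    then show "0 \<le> h (radial_avg N b x)"
      using b by (intro gauge_fun_nonneg[OF h] radial_avg_nonneg) (auto simp: cont_nonneg_def)
  qed (use rs in auto)
  then show ?thesis by (simp add: radial_profile_def)
qed

lemma radial_profile_ge:
  assumes "1 \<le> N" "gauge_fun h" "cont_nonneg b" "0 \<le> r"
  shows "\<gamma> \<le> radial_profile N h \<gamma> b r"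
  using radial_profile_incr[OF assms(1-3), of 0 r \<gamma>] assms(4) by simp

section \<open>From the half-line to the whole space\<close>

text \<open>The vanishing slope at 0 is what makes a radial function differentiable at the origin.\<close>

lemma GDERIV_radial:
  fixes x :: "'a::euclidean_space"
  assumes u: "\<And>r. 0 \<le> r \<Longrightarrow> (u has_real_derivative u' r) (at r within {0..})"
    and u'0: "u' 0 = 0"
  shows "GDERIV (\<lambda>y. u (norm y)) x :> (u' (norm x) / norm x) *\<^sub>R x"
proof (cases "x = 0")
  case False
  have "at (norm x) within {0..} = at (norm x)"
    by (rule at_within_interior) (use False in auto)
  then have "(u has_real_derivative u' (norm x)) (at (norm x))"
    using u[of "norm x"] by simp
  from GDERIV_DERIV_compose[OF GDERIV_norm[OF False] this] show ?thesis
    by (simp add: sgn_div_norm divide_inverse mult.commute)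
next
  case True
  \<comment> \<open>the norm is not differentiable at the origin, but it maps punctured neighbourhoods of the
      origin to punctured right neighbourhoods of 0, and there \<open>u\<close> is flat\<close>
  have "(u has_derivative (*) (u' 0)) (at 0 within {0..})"
    using u[of 0] by (simp add: has_field_derivative_def)
  then have lim: "((\<lambda>s. norm (u s - u 0) / norm s) \<longlongrightarrow> 0) (at 0 within {0..})"
    using u'0 by (simp add: has_derivative_iff_norm)
  have norm: "filterlim norm (at 0 within {0..}) (at (0::'a))"
    unfolding filterlim_at
  proof
    show "\<forall>\<^sub>F y in at (0::'a). norm y \<in> {0..} \<and> norm y \<noteq> 0"
      by (auto simp: eventually_at_filter)
    show "(norm \<longlongrightarrow> 0) (at (0::'a))"
      by (auto intro!: tendsto_eq_intros)
  qed
  have "((\<lambda>y. norm (u (norm y) - u 0) / norm (norm y)) \<longlongrightarrow> 0) (at (0::'a))"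
    using filterlim_compose[OF lim norm] .
  then show ?thesis
    using True by (simp add: gderiv_def has_derivative_iff_norm)
qed

lemma has_divergence_radial_field:
  fixes x :: "'a::euclidean_space"
  assumes x: "x \<noteq> 0" and k: "(k has_real_derivative D) (at (norm x))"
  shows "has_divergence (\<lambda>y. k (norm y) *\<^sub>R y) (k (norm x) * real DIM('a) + D * norm x) x"
proof -
  have kn: "((\<lambda>y. k (norm y)) has_derivative (\<lambda>h. h \<bullet> (D *\<^sub>R sgn x))) (at x)"
    using GDERIV_DERIV_compose[OF GDERIV_norm[OF x] k] by (simp add: gderiv_def)
  let ?F = "\<lambda>h. k (norm x) *\<^sub>R h + (h \<bullet> (D *\<^sub>R sgn x)) *\<^sub>R x"
  have "((\<lambda>y. k (norm y) *\<^sub>R y) has_derivative ?F) (at x)"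
    using has_derivative_scaleR[OF kn has_derivative_ident] .
  moreover have "(\<Sum>b\<in>Basis. ?F b \<bullet> b) = k (norm x) * real DIM('a) + D * norm x"
  proof -
    have "(\<Sum>b\<in>Basis. ?F b \<bullet> b) = (\<Sum>b\<in>Basis. k (norm x) + D * ((sgn x \<bullet> b) * (x \<bullet> b)))"
      by (intro sum.cong refl)
         (simp add: inner_add_left inner_commute[of _ "sgn x"])
    also have "\<dots> = (\<Sum>b\<in>(Basis :: 'a set). k (norm x)) + D * (\<Sum>b\<in>Basis. (sgn x \<bullet> b) * (x \<bullet> b))"
      by (simp only: sum.distrib sum_distrib_left)
    also have "(\<Sum>b\<in>Basis. (sgn x \<bullet> b) * (x \<bullet> b)) = sgn x \<bullet> x"
      by (rule euclidean_inner[symmetric])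
    also have "sgn x \<bullet> x = norm x"
      using x by (simp add: sgn_div_norm dot_square_norm power2_eq_square)
    finally show ?thesis by (simp add: mult.commute)
  qed
  ultimately show ?thesis unfolding has_divergence_def by (intro exI[of _ ?F]) simp
qed

lemma has_divergence_radial_field_origin:
  assumes k: "(k \<longlongrightarrow> L) (at_right 0)"
  shows "has_divergence (\<lambda>y::'a::euclidean_space. k (norm y) *\<^sub>R y) (L * real DIM('a)) 0"
proof -
  have norm: "filterlim norm (at_right 0) (at (0::'a))"
    unfolding filterlim_at
  proof
    show "\<forall>\<^sub>F y in at (0::'a). norm y \<in> {0<..} \<and> norm y \<noteq> 0"
      by (auto simp: eventually_at_filter)
    show "(norm \<longlongrightarrow> 0) (at (0::'a))"
      by (auto intro!: tendsto_eq_intros)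
  qed
  have "((\<lambda>y. norm (k (norm y) - L)) \<longlongrightarrow> 0) (at (0::'a))"
    by (intro tendsto_norm_zero LIM_zero filterlim_compose[OF k norm])
  moreover have "\<forall>\<^sub>F y in at (0::'a). norm (k (norm y) - L)
      = norm (k (norm y) *\<^sub>R y - k (norm (0::'a)) *\<^sub>R 0 - L *\<^sub>R (y - 0)) / norm (y - 0)"
    by (auto simp: eventually_at_filter simp flip: scaleR_diff_left)
  ultimately have "((\<lambda>y. norm (k (norm y) *\<^sub>R y - k (norm (0::'a)) *\<^sub>R 0 - L *\<^sub>R (y - 0)) / norm (y - 0))
      \<longlongrightarrow> 0) (at (0::'a))"
    by (rule Lim_transform_eventually)
  then have "((\<lambda>y::'a. k (norm y) *\<^sub>R y) has_derivative (\<lambda>h. L *\<^sub>R h)) (at 0)"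
    by (simp add: has_derivative_iff_norm bounded_linear_scaleR_right)
  moreover have "(\<Sum>b\<in>Basis. (L *\<^sub>R b) \<bullet> (b::'a)) = L * real DIM('a)"
    by (simp add: mult.commute)
  ultimately show ?thesis
    unfolding has_divergence_def by (intro exI[of _ "\<lambda>h. L *\<^sub>R h"]) simp
qed

lemma flux_h_inv:
  assumes adm: "admissible_phi \<phi> k_lo k_up \<theta>_lo \<theta>_up \<psi>_lo \<psi>_up" and s: "0 \<le> s"
  shows "\<phi> \<bar>h_inv \<phi> s\<bar> * h_inv \<phi> s = s"
proof (cases "s = 0")
  case False
  with h_inv_right_inverse[OF adm, of s] s show ?thesis
    by (simp add: h_fun_def mult.commute)
qed (simp add: h_inv_def)

text \<open>The flux of a profile is the field with value \<open>(radial_avg N b s / s) y\<close> at \<open>y\<close>, where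
  \<open>s = norm y\<close>. Away from the origin its divergence is computed by the quotient rule applied to
  \<open>s ^ -N\<close> times the integral of \<open>z ^ (N - 1) * b z\<close>; at the origin by the limit of the factor.\<close>

lemma phi_laplacian_radial_profile:
  assumes adm: "admissible_phi \<phi> k_lo k_up \<theta>_lo \<theta>_up \<psi>_lo \<psi>_up" and b: "cont_nonneg b"
  shows "phi_laplacian_eq \<phi>
    (\<lambda>x::'a::euclidean_space. radial_profile DIM('a) (h_inv \<phi>) \<gamma> b (norm x)) (\<lambda>x. b (norm x))"
proof -
  let ?N = "DIM('a)"
  let ?u' = "\<lambda>r. h_inv \<phi> (radial_avg ?N b r)"
  let ?G = "\<lambda>x::'a. (?u' (norm x) / norm x) *\<^sub>R x"
  let ?k = "\<lambda>s. radial_avg ?N b s / s"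
  let ?I = "\<lambda>s. integral {0..s} (\<lambda>z. z ^ (?N - 1) * b z)"
  have N: "1 \<le> ?N" using DIM_positive[where 'a='a] by linarith
  have bc: "continuous_on {0..} b" and bn: "\<And>t. 0 \<le> t \<Longrightarrow> 0 \<le> b t"
    using b by (auto simp: cont_nonneg_def)
  have gauge: "gauge_fun (h_inv \<phi>)" by (rule gauge_fun_h_inv[OF adm])
  have avg: "0 \<le> radial_avg ?N b s" for s by (rule radial_avg_nonneg[OF bc bn])
  have flux: "\<phi> (norm (?G y)) *\<^sub>R ?G y = ?k (norm y) *\<^sub>R y" for y :: 'a
  proof (cases "y = 0")
    case False
    then have "norm (?G y) = \<bar>?u' (norm y)\<bar>" by simp
    then show ?thesis
      using flux_h_inv[OF adm avg[of "norm y"]] by (simp add: mult.commute)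
  qed simp
  have div: "has_divergence (\<lambda>y. ?k (norm y) *\<^sub>R y) (b (norm x)) x" for x :: 'a
  proof (cases "x = 0")
    case True
    have "b 0 / real ?N * real ?N = b 0" using N by simp
    then show ?thesis
      using True has_divergence_radial_field_origin[OF radial_avg_ratio_tendsto[OF N bc], where 'a='a]
      by simp
  next
    case False
    define r where "r = norm x"
    have r: "0 < r" using False by (simp add: r_def)
    obtain m where m: "?N = Suc m" using N by (cases ?N) auto
    let ?D = "(r ^ m * b r * r ^ Suc m - ?I r * (real (Suc m) * r ^ m)) / (r ^ Suc m * r ^ Suc m)"
    have "((\<lambda>s. ?I s / s ^ Suc m) has_real_derivative ?D) (at r)"
    proof (rule DERIV_divide)
      show "(?I has_real_derivative r ^ m * b r) (at r)"
        using halfline_integral_deriv_interior[OF radial_integrand_continuous[OF bc, of ?N] r] m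
        by simp
      show "((\<lambda>s. s ^ Suc m) has_real_derivative real (Suc m) * r ^ m) (at r)"
        using DERIV_pow[of "Suc m" r] by simp
    qed (use r in simp)
    then have "(?k has_real_derivative ?D) (at r)"
    proof (rule has_field_derivative_transform_within[OF _ r UNIV_I])
      fix s assume "dist s r < r"
      then have "0 < s" by (auto simp: dist_real_def)
      then show "?I s / s ^ Suc m = ?k s"
        using N m by (simp add: radial_avg_eq_divide mult.commute)
    qed
    then have "has_divergence (\<lambda>y. ?k (norm y) *\<^sub>R y) (?k r * real ?N + ?D * r) x"
      using has_divergence_radial_field[OF False, of ?k ?D] by (simp add: r_def)
    moreover have "?k r * real ?N + ?D * r = b r"
    proof -
      have "?k r = ?I r / r ^ Suc m"
        using N m r by (simp add: radial_avg_eq_divide mult.commute)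
      moreover have "?D * r = b r - ?I r * real (Suc m) / r ^ Suc m"
        using r by (simp add: field_simps)
      ultimately show ?thesis by (simp add: m)
    qed
    ultimately show ?thesis by (simp add: r_def)
  qed
  have "GDERIV (\<lambda>x. radial_profile ?N (h_inv \<phi>) \<gamma> b (norm x)) x :> ?G x" for x :: 'a
    by (rule GDERIV_radial[OF radial_profile_deriv])
       (use N gauge b in \<open>auto simp: gauge_fun_def\<close>)
  then show ?thesis
    unfolding phi_laplacian_eq_def by (intro exI[of _ ?G]) (simp only: flux div simp_thms)
qed

lemma C1_halfline_radial_profile:
  assumes "1 \<le> N" "gauge_fun h" "cont_nonneg b"
  shows "C1_halfline (radial_profile N h \<gamma> b) (\<lambda>r. h (radial_avg N b r))"
proof -
  have h: "continuous_on {0..} h" using assms(2) by (simp add: gauge_fun_def)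
  show ?thesis
    unfolding C1_halfline_def
    using radial_profile_deriv[OF assms(1) h assms(3)]
      gauge_radial_avg_continuous[OF assms(1) h assms(3)] by blast
qed

lemma radial_eq_radial_profile:
  assumes adm: "admissible_phi \<phi> k_lo k_up \<theta>_lo \<theta>_up \<psi>_lo \<psi>_up" and N: "1 \<le> N"
    and b: "cont_nonneg b"
  shows "radial_eq N \<phi> (\<lambda>r. h_inv \<phi> (radial_avg N b r)) b"
  unfolding radial_eq_def
proof (intro allI impI)
  fix r :: real assume r: "0 \<le> r"
  have bc: "continuous_on {0..} b" and bn: "\<And>t. 0 \<le> t \<Longrightarrow> 0 \<le> b t"
    using b by (auto simp: cont_nonneg_def)
  have flux: "integral {0..s} (\<lambda>z. z ^ (N - 1) * b z) =
      s ^ (N - 1) * (\<phi> \<bar>h_inv \<phi> (radial_avg N b s)\<bar> * h_inv \<phi> (radial_avg N b s))"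
    if "0 \<le> s" for s
    using flux_h_inv[OF adm radial_avg_nonneg[OF bc bn, of N s]] that N
    by (cases "s = 0") (simp_all add: radial_avg_eq_divide)
  show "((\<lambda>s. s ^ (N - 1) * (\<phi> \<bar>h_inv \<phi> (radial_avg N b s)\<bar> * h_inv \<phi> (radial_avg N b s)))
      has_real_derivative r ^ (N - 1) * b r) (at r within {0..})"
    by (rule has_field_derivative_transform_within[OF
          halfline_integral_deriv[OF radial_integrand_continuous[OF bc] r] zero_less_one])
       (use r flux in auto)
qed

section \<open>Monotone iteration for the coupled system\<close>

text \<open>Passage to the limit under both integral signs. The limit forcing \<open>b\<close> need not be
  continuous: dominated convergence provides the integrability, and continuity of the limit
  profile is part of the conclusion.\<close>

lemma radial_profile_limit:
  assumes N: "1 \<le> N" and h: "gauge_fun h" and bs: "\<And>n. cont_nonneg (bs n)"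
    and bdd: "\<And>r. 0 \<le> r \<Longrightarrow> \<exists>C. \<forall>n. \<forall>t\<in>{0..r}. bs n t \<le> C"
    and lim: "\<And>t. 0 \<le> t \<Longrightarrow> (\<lambda>n. bs n t) \<longlonglongrightarrow> b t"
  shows "0 \<le> r \<Longrightarrow> (\<lambda>n. radial_profile N h \<gamma> (bs n) r) \<longlonglongrightarrow> radial_profile N h \<gamma> b r"
    and "continuous_on {0..} (radial_profile N h \<gamma> b)"
proof -
  have hc: "continuous_on {0..} h" using h by (simp add: gauge_fun_def)
  have bc: "continuous_on {0..} (bs n)" and bn: "0 \<le> t \<Longrightarrow> 0 \<le> bs n t" for n t
    using bs[of n] by (auto simp: cont_nonneg_def)
  have avg_n: "0 \<le> radial_avg N (bs n) s" for n s by (rule radial_avg_nonneg[OF bc bn])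
  have avg_lim: "(\<lambda>n. radial_avg N (bs n) s) \<longlonglongrightarrow> radial_avg N b s" if s: "0 \<le> s" for s
  proof -
    obtain C where C: "\<forall>n. \<forall>t\<in>{0..s}. bs n t \<le> C" using bdd[OF s] by blast
    have "(\<lambda>n. integral {0..s} (\<lambda>z. z ^ (N - 1) * bs n z))
        \<longlonglongrightarrow> integral {0..s} (\<lambda>z. z ^ (N - 1) * b z)"
    proof (rule dominated_convergence(2)[where h = "\<lambda>z. z ^ (N - 1) * C"])
      show "(\<lambda>z. z ^ (N - 1) * bs n z) integrable_on {0..s}" for n
        by (rule halfline_integrable[OF radial_integrand_continuous[OF bc]])
      show "(\<lambda>z. z ^ (N - 1) * C) integrable_on {0..s}"
        by (rule halfline_integrable[OF radial_integrand_continuous]) simp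
      show "norm (z ^ (N - 1) * bs n z) \<le> z ^ (N - 1) * C" if "z \<in> {0..s}" for n z
        using that C bn[of z n] by (auto simp: abs_mult intro!: mult_left_mono)
      show "(\<lambda>n. z ^ (N - 1) * bs n z) \<longlonglongrightarrow> z ^ (N - 1) * b z" if "z \<in> {0..s}" for z
        using that by (intro tendsto_intros lim) simp
    qed
    then show ?thesis unfolding radial_avg_def by (intro tendsto_intros)
  qed
  have avg_b: "0 \<le> radial_avg N b s" if "0 \<le> s" for s
    using avg_lim[OF that] avg_n by (intro LIMSEQ_le_const) auto
  have main: "(\<lambda>s. h (radial_avg N b s)) integrable_on {0..r}"
      "(\<lambda>n. integral {0..r} (\<lambda>s. h (radial_avg N (bs n) s)))
        \<longlonglongrightarrow> integral {0..r} (\<lambda>s. h (radial_avg N b s))" if r: "0 \<le> r" for r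
  proof -
    obtain C where C: "\<forall>n. \<forall>t\<in>{0..r}. bs n t \<le> C" using bdd[OF r] by blast
    let ?H = "\<lambda>s. h (radial_avg N (\<lambda>_. max C 0) s)"
    have *: "(\<lambda>s. h (radial_avg N (bs n) s)) integrable_on {0..r}" for n
      by (rule halfline_integrable[OF gauge_radial_avg_continuous[OF N hc bs]])
    have **: "?H integrable_on {0..r}"
      by (rule halfline_integrable[OF gauge_radial_avg_continuous[OF N hc]])
         (simp add: cont_nonneg_def)
    have ***: "norm (h (radial_avg N (bs n) s)) \<le> ?H s" if "s \<in> {0..r}" for n s
    proof -
      have "radial_avg N (bs n) s \<le> radial_avg N (\<lambda>_. max C 0) s"
        by (rule radial_avg_mono[OF bc]) (use that C in \<open>auto simp: le_max_iff_disj\<close>)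
      then show ?thesis
        using gauge_fun_le[OF h avg_n] gauge_fun_nonneg[OF h avg_n] by simp
    qed
    have ****: "(\<lambda>n. h (radial_avg N (bs n) s)) \<longlonglongrightarrow> h (radial_avg N b s)" if "s \<in> {0..r}" for s
      by (rule continuous_on_tendsto_compose[OF hc avg_lim]) (use that avg_b avg_n in auto)
    show "(\<lambda>s. h (radial_avg N b s)) integrable_on {0..r}"
      by (rule dominated_convergence(1)[OF * ** *** ****])
    show "(\<lambda>n. integral {0..r} (\<lambda>s. h (radial_avg N (bs n) s)))
        \<longlonglongrightarrow> integral {0..r} (\<lambda>s. h (radial_avg N b s))"
      by (rule dominated_convergence(2)[OF * ** *** ****])
  qed
  show "(\<lambda>n. radial_profile N h \<gamma> (bs n) r) \<longlonglongrightarrow> radial_profile N h \<gamma> b r" if "0 \<le> r"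
    unfolding radial_profile_def by (intro tendsto_intros main(2) that)
  show "continuous_on {0..} (radial_profile N h \<gamma> b)"
    unfolding continuous_on_def
  proof
    fix r :: real assume "r \<in> {0..}"
    then have r: "0 \<le> r" by simp
    have "continuous_on {0..r+1} (radial_profile N h \<gamma> b)"
      unfolding radial_profile_def[abs_def]
      by (intro continuous_intros indefinite_integral_continuous_1 main(1)) (use r in simp)
    then have "(radial_profile N h \<gamma> b \<longlongrightarrow> radial_profile N h \<gamma> b r) (at r within {0..r+1})"
      using r by (simp add: continuous_on_def)
    moreover have "at r within {0..r+1} = at r within {0..}"
      by (rule at_within_nhd[of r "{..<r+1}"]) auto
    ultimately show "(radial_profile N h \<gamma> b \<longlongrightarrow> radial_profile N h \<gamma> b r) (at r within {0..})"
      by simp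
  qed
qed

definition incr_from :: "real \<Rightarrow> (real \<Rightarrow> real) \<Rightarrow> bool" where
  "incr_from \<gamma> w \<longleftrightarrow> continuous_on {0..} w \<and> mono_on {0..} w \<and> (\<forall>t\<ge>0. \<gamma> \<le> w t)"

definition forced_profile ::
  "nat \<Rightarrow> (real \<Rightarrow> real) \<Rightarrow> real \<Rightarrow> (real \<Rightarrow> real) \<Rightarrow> (real \<Rightarrow> real) \<Rightarrow> (real \<Rightarrow> real) \<Rightarrow> real \<Rightarrow> real" where
  "forced_profile N h \<gamma> a f w = radial_profile N h \<gamma> (\<lambda>t. a t * f (w t))"

lemma cont_nonneg_forcing:
  assumes a: "cont_nonneg a" and f: "cont_nonneg f"
    and w: "continuous_on {0..} w" "\<And>t. 0 \<le> t \<Longrightarrow> 0 \<le> w t"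
  shows "cont_nonneg (\<lambda>t. a t * f (w t))"
  unfolding cont_nonneg_def
proof (intro conjI allI impI)
  show "continuous_on {0..} (\<lambda>t. a t * f (w t))"
    by (intro continuous_intros continuous_on_compose2[of "{0..}" f _ w])
       (use assms in \<open>auto simp: cont_nonneg_def\<close>)
qed (use assms in \<open>auto simp: cont_nonneg_def\<close>)

lemma cont_nonneg_forcing_incr:
  assumes "cont_nonneg a" "cont_nonneg_incr f" "incr_from \<gamma> w" "0 < \<gamma>"
  shows "cont_nonneg (\<lambda>t. a t * f (w t))"
  by (rule cont_nonneg_forcing)
     (use assms in \<open>force simp: cont_nonneg_incr_def incr_from_def\<close>)+

lemma incr_from_radial_profile:
  assumes "1 \<le> N" "gauge_fun h" "cont_nonneg b"
  shows "incr_from \<gamma> (radial_profile N h \<gamma> b)"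
  unfolding incr_from_def
proof (intro conjI allI impI mono_onI)
  show "continuous_on {0..} (radial_profile N h \<gamma> b)"
    by (rule radial_profile_continuous[OF assms(1) _ assms(3)])
       (use assms(2) in \<open>simp add: gauge_fun_def\<close>)
  show "radial_profile N h \<gamma> b r \<le> radial_profile N h \<gamma> b s" if "r \<in> {0..}" "s \<in> {0..}" "r \<le> s" for r s
    by (rule radial_profile_incr[OF assms]) (use that in auto)
  show "\<gamma> \<le> radial_profile N h \<gamma> b r" if "0 \<le> r" for r
    by (rule radial_profile_ge[OF assms that])
qed

lemma forced_profile_mono:
  assumes N: "1 \<le> N" and h: "gauge_fun h" and a: "cont_nonneg a" and f: "cont_nonneg_incr f"
    and \<gamma>: "0 < \<gamma>" and v: "incr_from \<gamma> v" and w: "incr_from \<gamma> w"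
    and le: "\<And>t. 0 \<le> t \<Longrightarrow> v t \<le> w t"
  shows "forced_profile N h \<delta> a f v r \<le> forced_profile N h \<delta> a f w r"
  unfolding forced_profile_def
proof (rule radial_profile_mono[OF N h])
  fix t :: real assume t: "0 \<le> t"
  have "0 \<le> v t" using v t \<gamma> by (force simp: incr_from_def)
  then have "f (v t) \<le> f (w t)"
    using f le[OF t] by (auto simp: cont_nonneg_incr_def mono_on_def)
  then show "a t * f (v t) \<le> a t * f (w t)"
    using a t by (auto simp: cont_nonneg_def intro: mult_left_mono)
qed (rule cont_nonneg_forcing_incr[OF a f _ \<gamma>]; fact)+

text \<open>Limits of increasing sequences of profiles below a barrier can be inserted into the
  operator. The barrier only has to be finite at every point, because the profiles are themselves
  nondecreasing in the radius.\<close>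

lemma forced_profile_limit:
  assumes N: "1 \<le> N" and h: "gauge_fun h" and a: "cont_nonneg a" and f: "cont_nonneg_incr f"
    and \<gamma>: "0 < \<gamma>" and ws: "\<And>n. incr_from \<gamma> (ws n)"
    and bdd: "\<And>n r. 0 \<le> r \<Longrightarrow> ws n r \<le> B r"
    and lim: "\<And>t. 0 \<le> t \<Longrightarrow> (\<lambda>n. ws n t) \<longlonglongrightarrow> w t"
  shows "0 \<le> r \<Longrightarrow> (\<lambda>n. forced_profile N h \<delta> a f (ws n) r) \<longlonglongrightarrow> forced_profile N h \<delta> a f w r"
    and "continuous_on {0..} (forced_profile N h \<delta> a f w)"
proof -
  have wpos: "0 \<le> ws n t" if "0 \<le> t" for n t
    using ws[of n] that \<gamma> by (force simp: incr_from_def)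
  have fc: "continuous_on {0..} f" and fmono: "mono_on {0..} f" and f0: "\<And>t. 0 \<le> t \<Longrightarrow> 0 \<le> f t"
    using f by (auto simp: cont_nonneg_incr_def cont_nonneg_def)
  have ac: "continuous_on {0..} a" and a0: "\<And>t. 0 \<le> t \<Longrightarrow> 0 \<le> a t"
    using a by (auto simp: cont_nonneg_def)
  have b: "cont_nonneg (\<lambda>t. a t * f (ws n t))" for n
    by (rule cont_nonneg_forcing_incr[OF a f ws \<gamma>])
  have bound: "\<exists>C. \<forall>n. \<forall>t\<in>{0..r}. a t * f (ws n t) \<le> C" if r: "0 \<le> r" for r
  proof -
    have "bdd_above (a ` {0..r})"
      by (intro bounded_imp_bdd_above compact_imp_bounded compact_continuous_image
            continuous_on_subset[OF ac]) auto
    then obtain C where C: "\<And>t. t \<in> {0..r} \<Longrightarrow> a t \<le> C"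
      unfolding bdd_above_def by blast
    have "a t * f (ws n t) \<le> C * f (B r)" if t: "t \<in> {0..r}" for n t
    proof (rule mult_mono)
      have "ws n t \<le> ws n r" using ws[of n] t by (auto simp: incr_from_def mono_on_def)
      also have "\<dots> \<le> B r" by (rule bdd[OF r])
      finally show "f (ws n t) \<le> f (B r)"
        using fmono wpos[of t n] t by (auto simp: mono_on_def)
    qed (use C t a0[of t] f0 wpos[of t n] in \<open>auto intro: order_trans\<close>)
    then show ?thesis by blast
  qed
  have conv: "(\<lambda>n. a t * f (ws n t)) \<longlonglongrightarrow> a t * f (w t)" if t: "0 \<le> t" for t
  proof -
    have "0 \<le> w t" using lim[OF t] wpos[OF t] by (intro LIMSEQ_le_const) auto
    then show ?thesis
      by (intro tendsto_intros continuous_on_tendsto_compose[OF fc lim[OF t]])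
         (use wpos t in auto)
  qed
  show "(\<lambda>n. forced_profile N h \<delta> a f (ws n) r) \<longlonglongrightarrow> forced_profile N h \<delta> a f w r" if "0 \<le> r"
    unfolding forced_profile_def by (rule radial_profile_limit(1)[OF N h b bound conv that])
  show "continuous_on {0..} (forced_profile N h \<delta> a f w)"
    unfolding forced_profile_def by (rule radial_profile_limit(2)[OF N h b bound conv])
qed

text \<open>Starting from the constants, both components are iterated simultaneously. Since the
  operators are monotone the iterates increase, so that a pair of successive iterates solves one
  equation exactly and satisfies the other one as an inequality. The a priori bounds are therefore
  required precisely for such pairs.\<close>

lemma coupled_solution_exists:
  assumes N: "1 \<le> N" and h1: "gauge_fun h1" and h2: "gauge_fun h2"
    and a1: "cont_nonneg a1" and a2: "cont_nonneg a2"
    and f1: "cont_nonneg_incr f1" and f2: "cont_nonneg_incr f2"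
    and \<alpha>: "0 < \<alpha>" and \<beta>: "0 < \<beta>"
    and bd1: "\<And>u v r. incr_from \<alpha> u \<Longrightarrow> incr_from \<beta> v \<Longrightarrow> u = forced_profile N h1 \<alpha> a1 f1 v \<Longrightarrow>
        (\<And>t. 0 \<le> t \<Longrightarrow> v t \<le> forced_profile N h2 \<beta> a2 f2 u t) \<Longrightarrow> 0 \<le> r \<Longrightarrow> u r \<le> B1 r"
    and bd2: "\<And>u v r. incr_from \<alpha> u \<Longrightarrow> incr_from \<beta> v \<Longrightarrow> v = forced_profile N h2 \<beta> a2 f2 u \<Longrightarrow>
        (\<And>t. 0 \<le> t \<Longrightarrow> u t \<le> forced_profile N h1 \<alpha> a1 f1 v t) \<Longrightarrow> 0 \<le> r \<Longrightarrow> v r \<le> B2 r"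
  obtains u v where "incr_from \<alpha> u" "incr_from \<beta> v"
    "u = forced_profile N h1 \<alpha> a1 f1 v" "v = forced_profile N h2 \<beta> a2 f2 u"
proof -
  let ?T1 = "forced_profile N h1 \<alpha> a1 f1" and ?T2 = "forced_profile N h2 \<beta> a2 f2"
  define P where "P = rec_nat (\<lambda>_::real. \<alpha>, \<lambda>_::real. \<beta>) (\<lambda>_ p. (?T1 (snd p), ?T2 (fst p)))"
  define U where "U n = fst (P n)" for n
  define V where "V n = snd (P n)" for n
  have U0: "U 0 = (\<lambda>_. \<alpha>)" and V0: "V 0 = (\<lambda>_. \<beta>)"
    and US: "\<And>n. U (Suc n) = ?T1 (V n)" and VS: "\<And>n. V (Suc n) = ?T2 (U n)"
    by (simp_all add: U_def V_def P_def)
  have T1: "incr_from \<alpha> (?T1 v)" if "incr_from \<beta> v" for v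
    unfolding forced_profile_def
    by (rule incr_from_radial_profile[OF N h1 cont_nonneg_forcing_incr[OF a1 f1 that \<beta>]])
  have T2: "incr_from \<beta> (?T2 u)" if "incr_from \<alpha> u" for u
    unfolding forced_profile_def
    by (rule incr_from_radial_profile[OF N h2 cont_nonneg_forcing_incr[OF a2 f2 that \<alpha>]])
  have incr: "incr_from \<alpha> (U n) \<and> incr_from \<beta> (V n)" for n
  proof (induction n)
    case 0 show ?case by (simp add: U0 V0 incr_from_def mono_on_def)
  next
    case (Suc n) then show ?case by (simp add: US VS T1 T2)
  qed
  have step: "\<forall>r\<ge>0. U n r \<le> U (Suc n) r \<and> V n r \<le> V (Suc n) r" for n
  proof (induction n)
    case 0
    show ?case
      using T1[of "V 0"] T2[of "U 0"] incr[of 0] by (simp add: U0 V0 US VS incr_from_def)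
  next
    case (Suc n)
    have "U (Suc n) r \<le> U (Suc (Suc n)) r" for r
      unfolding US[of n] US[of "Suc n"]
      using forced_profile_mono[OF N h1 a1 f1 \<beta>, of "V n" "V (Suc n)" \<alpha> r] incr Suc.IH by blast
    moreover have "V (Suc n) r \<le> V (Suc (Suc n)) r" for r
      unfolding VS[of n] VS[of "Suc n"]
      using forced_profile_mono[OF N h2 a2 f2 \<alpha>, of "U n" "U (Suc n)" \<beta> r] incr Suc.IH by blast
    ultimately show ?case by blast
  qed
  have UB: "U n r \<le> B1 r" if r: "0 \<le> r" for n r
  proof -
    have "U (Suc n) r \<le> B1 r"
    proof (rule bd1[of _ "V n"])
      fix t :: real assume t: "0 \<le> t"
      have "V n t \<le> ?T2 (U n) t" using step[of n] t by (simp add: VS)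
      also have "\<dots> \<le> ?T2 (U (Suc n)) t"
        using forced_profile_mono[OF N h2 a2 f2 \<alpha>, of "U n" "U (Suc n)" \<beta> t] incr step[of n] by blast
      finally show "V n t \<le> ?T2 (U (Suc n)) t" .
    qed (use incr r US T1 in auto)
    moreover have "U n r \<le> U (Suc n) r" using step r by blast
    ultimately show ?thesis by linarith
  qed
  have VB: "V n r \<le> B2 r" if r: "0 \<le> r" for n r
  proof -
    have "V (Suc n) r \<le> B2 r"
    proof (rule bd2[of "U n"])
      fix t :: real assume t: "0 \<le> t"
      have "U n t \<le> ?T1 (V n) t" using step[of n] t by (simp add: US)
      also have "\<dots> \<le> ?T1 (V (Suc n)) t"
        using forced_profile_mono[OF N h1 a1 f1 \<beta>, of "V n" "V (Suc n)" \<alpha> t] incr step[of n] by blast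
      finally show "U n t \<le> ?T1 (V (Suc n)) t" .
    qed (use incr r VS T2 in auto)
    moreover have "V n r \<le> V (Suc n) r" using step r by blast
    ultimately show ?thesis by linarith
  qed
  define u where "u r = lim (\<lambda>n. U n r)" for r
  define v where "v r = lim (\<lambda>n. V n r)" for r
  have ulim: "(\<lambda>n. U n r) \<longlonglongrightarrow> u r" if "0 \<le> r" for r
  proof -
    have inc: "incseq (\<lambda>n. U n r)" by (rule incseq_SucI) (use step that in simp)
    have "\<forall>n. U n r \<le> B1 r" using UB[OF that] by simp
    with inc obtain L where "(\<lambda>n. U n r) \<longlonglongrightarrow> L" by (rule incseq_convergent)
    then show ?thesis by (simp add: u_def limI)
  qed
  have vlim: "(\<lambda>n. V n r) \<longlonglongrightarrow> v r" if "0 \<le> r" for r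
  proof -
    have inc: "incseq (\<lambda>n. V n r)" by (rule incseq_SucI) (use step that in simp)
    have "\<forall>n. V n r \<le> B2 r" using VB[OF that] by simp
    with inc obtain L where "(\<lambda>n. V n r) \<longlonglongrightarrow> L" by (rule incseq_convergent)
    then show ?thesis by (simp add: v_def limI)
  qed
  have lim1: "0 \<le> r \<Longrightarrow> (\<lambda>n. ?T1 (V n) r) \<longlonglongrightarrow> ?T1 v r" "continuous_on {0..} (?T1 v)" for r
    by (rule forced_profile_limit[OF N h1 a1 f1 \<beta> conjunct2[OF incr] VB vlim]; assumption)+
  have lim2: "0 \<le> r \<Longrightarrow> (\<lambda>n. ?T2 (U n) r) \<longlonglongrightarrow> ?T2 u r" "continuous_on {0..} (?T2 u)" for r
    by (rule forced_profile_limit[OF N h2 a2 f2 \<alpha> conjunct1[OF incr] UB ulim]; assumption)+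
  \<comment> \<open>for negative \<open>r\<close> the integral is empty and both sides are the initial value\<close>
  have uT: "u r = ?T1 v r" for r
  proof (cases "0 \<le> r")
    case True
    have "(\<lambda>n. U (Suc n) r) \<longlonglongrightarrow> ?T1 v r" using lim1(1)[OF True] by (simp add: US)
    then show ?thesis by (rule LIMSEQ_unique[OF LIMSEQ_Suc[OF ulim[OF True]]])
  next
    case False
    then have "U n r = \<alpha>" for n
      by (cases n) (simp_all add: U0 US forced_profile_def radial_profile_def)
    then show ?thesis using False by (simp add: u_def forced_profile_def radial_profile_def)
  qed
  have vT: "v r = ?T2 u r" for r
  proof (cases "0 \<le> r")
    case True
    have "(\<lambda>n. V (Suc n) r) \<longlonglongrightarrow> ?T2 u r" using lim2(1)[OF True] by (simp add: VS)
    then show ?thesis by (rule LIMSEQ_unique[OF LIMSEQ_Suc[OF vlim[OF True]]])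
  next
    case False
    then have "V n r = \<beta>" for n
      by (cases n) (simp_all add: V0 VS forced_profile_def radial_profile_def)
    then show ?thesis using False by (simp add: v_def forced_profile_def radial_profile_def)
  qed
  have eq: "u = ?T1 v" "v = ?T2 u" using uT vT by auto
  have "v t \<ge> \<beta>" if "0 \<le> t" for t
    using vlim[OF that] incr that by (intro LIMSEQ_le_const) (auto simp: incr_from_def)
  moreover have "v s \<le> v t" if "0 \<le> s" "s \<le> t" for s t
    using vlim[of s] vlim[of t] incr that
    by (intro LIMSEQ_le[of "\<lambda>n. V n s" _ "\<lambda>n. V n t"]) (auto simp: incr_from_def mono_on_def)
  moreover have "continuous_on {0..} v" by (subst eq(2)) (rule lim2(2))
  ultimately have v: "incr_from \<beta> v" by (simp add: incr_from_def mono_on_def)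
  have "incr_from \<alpha> u" by (subst eq(1)) (rule T1[OF v])
  then show thesis by (rule that[OF _ v eq])
qed

section \<open>Two-sided estimates of the inverse function\<close>

lemma theta_up_pos:
  assumes adm: "admissible_phi \<phi> k_lo k_up \<theta>_lo \<theta>_up \<psi>_lo \<psi>_up" and s: "0 < s"
  shows "0 < \<theta>_up s"
proof (rule ccontr)
  assume "\<not> 0 < \<theta>_up s"
  moreover have "0 \<le> \<theta>_up s"
    using adm s by (simp add: admissible_phi_def cont_nonneg_incr_def cont_nonneg_def)
  ultimately have zero: "\<theta>_up s = 0" by simp
  have "\<forall>s1>0. \<forall>s2>0. h_inv \<phi> (s1 * s2) \<le> k_up * \<theta>_up s1 * \<psi>_up s2"
    using adm by (simp add: admissible_phi_def)
  from this[rule_format, of s 1] have "h_inv \<phi> s \<le> 0" using s zero by simp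
  then show False using h_inv_right_inverse(1)[OF adm s] by simp
qed

lemma h_inv_upper:
  assumes adm: "admissible_phi \<phi> k_lo k_up \<theta>_lo \<theta>_up \<psi>_lo \<psi>_up" and s: "0 < s1" "0 \<le> s2"
  shows "h_inv \<phi> (s1 * s2) \<le> k_up * \<theta>_up s1 * \<psi>_up s2"
proof (cases "s2 = 0")
  case True
  then show ?thesis
    using adm s by (simp add: h_inv_def admissible_phi_def cont_nonneg_incr_def cont_nonneg_def)
next
  case False
  then show ?thesis using adm s by (simp add: admissible_phi_def)
qed

text \<open>For \<open>s2 = 0\<close> the lower estimate says that \<open>\<psi>_lo 0\<close> must vanish unless \<open>\<theta>_lo s1\<close> does; it is
  the limit of the estimate for positive \<open>s2\<close>.\<close>

lemma h_inv_lower: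
  assumes adm: "admissible_phi \<phi> k_lo k_up \<theta>_lo \<theta>_up \<psi>_lo \<psi>_up" and s: "0 < s1" "0 \<le> s2"
  shows "k_lo * \<theta>_lo s1 * \<psi>_lo s2 \<le> h_inv \<phi> (s1 * s2)"
proof (cases "s2 = 0")
  case True
  have right: "at_right (0::real) \<le> at 0 within {0..}"
    by (rule at_le) auto
  have "continuous_on {0..} (\<lambda>x. k_lo * \<theta>_lo s1 * \<psi>_lo x)"
    by (intro continuous_intros)
       (use adm in \<open>simp add: admissible_phi_def cont_nonneg_def\<close>)
  moreover have "continuous_on {0..} (\<lambda>x. h_inv \<phi> (s1 * x))"
    by (rule continuous_on_compose2[of "{0..}" "h_inv \<phi>"])
       (use gauge_fun_h_inv[OF adm] s in \<open>auto simp: gauge_fun_def intro!: continuous_intros\<close>)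
  ultimately have "((\<lambda>x. k_lo * \<theta>_lo s1 * \<psi>_lo x) \<longlongrightarrow> k_lo * \<theta>_lo s1 * \<psi>_lo 0) (at_right 0)"
      "((\<lambda>x. h_inv \<phi> (s1 * x)) \<longlongrightarrow> h_inv \<phi> (s1 * 0)) (at_right 0)"
    unfolding continuous_on_def by (blast intro: tendsto_mono[OF right])+
  moreover have "\<forall>\<^sub>F x in at_right 0. k_lo * \<theta>_lo s1 * \<psi>_lo x \<le> h_inv \<phi> (s1 * x)"
    using adm s by (auto simp: eventually_at_filter admissible_phi_def)
  ultimately show ?thesis
    using True by (auto intro: tendsto_le[OF trivial_limit_at_right_real])
next
  case False
  then show ?thesis using adm s by (simp add: admissible_phi_def)
qed

lemma A_fun_continuous:
  assumes "1 \<le> N" "cont_nonneg \<psi>" "cont_nonneg a"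
  shows "continuous_on {0..} (A_fun N k \<psi> a)"
  unfolding A_fun_def[abs_def]
  by (intro halfline_integral_continuous continuous_on_mult_left gauge_radial_avg_continuous)
     (use assms in \<open>auto simp: cont_nonneg_def\<close>)

lemma A_fun_nonneg:
  assumes N: "1 \<le> N" and k: "0 \<le> k" and \<psi>: "cont_nonneg \<psi>" and a: "cont_nonneg a"
  shows "0 \<le> A_fun N k \<psi> a t"
  unfolding A_fun_def
proof (rule integral_nonneg)
  have "continuous_on {0..} (\<lambda>s. k * \<psi> (radial_avg N a s))"
    using gauge_radial_avg_continuous[OF N _ a, of \<psi>] \<psi>
    by (intro continuous_on_mult_left) (simp add: cont_nonneg_def)
  then show "(\<lambda>s. k * \<psi> (radial_avg N a s)) integrable_on {0..t}"
    by (rule halfline_integrable)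
  show "0 \<le> k * \<psi> (radial_avg N a s)" for s
    using k \<psi> radial_avg_nonneg[of a N s] a by (simp add: cont_nonneg_def)
qed

lemma cont_nonneg_weight:
  assumes N: "1 \<le> N" and k: "0 \<le> k" and c: "0 \<le> c" and \<psi>: "cont_nonneg \<psi>" and \<xi>: "cont_nonneg \<xi>"
    and a: "cont_nonneg a" and b: "cont_nonneg b"
  shows "cont_nonneg (\<lambda>t. c * (a t * \<xi> (1 + A_fun N k \<psi> b t)))"
proof -
  have "cont_nonneg (\<lambda>t. a t * \<xi> (1 + A_fun N k \<psi> b t))"
  proof (rule cont_nonneg_forcing[OF a \<xi>])
    show "continuous_on {0..} (\<lambda>t. 1 + A_fun N k \<psi> b t)"
      by (intro continuous_intros A_fun_continuous N \<psi> b)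
    show "0 \<le> 1 + A_fun N k \<psi> b t" for t
      using A_fun_nonneg[OF N k \<psi> b, of t] by simp
  qed
  then show ?thesis using c by (simp add: cont_nonneg_def continuous_on_mult_left)
qed

text \<open>The functions \<open>P_fun\<close> are themselves profiles, which makes the comparison with a component
  of a solution a comparison of forcings.\<close>

lemma radial_profile_weight:
  "radial_profile N h \<gamma> (\<lambda>t. c * (a t * \<xi> (1 + A t))) r = \<gamma> + P_fun N h c a \<xi> A r"
  by (simp add: radial_profile_def P_fun_def radial_avg_cmult)

text \<open>Since \<open>u \<ge> \<alpha>\<close>, the second equation forces \<open>v\<close> to grow at least like \<open>m * (1 + A)\<close>, which is the
  form of argument at which \<open>f1\<close> is bounded below; the first equation then carries this over to
  \<open>u\<close>.\<close>

lemma component_lower_bound: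
  assumes N: "1 \<le> N" and h1: "gauge_fun h1"
    and adm2: "admissible_phi \<phi>2 klo2 kup2 \<theta>lo2 \<theta>up2 \<psi>lo2 \<psi>up2"
    and a: "cont_nonneg a1" "cont_nonneg a2"
    and f: "cont_nonneg_incr f1" "cont_nonneg_incr f2" and f2_pos: "0 < f2 \<alpha>"
    and \<alpha>: "0 < \<alpha>" and \<beta>: "0 < \<beta>" and c: "0 < c" and \<xi>: "cont_nonneg \<xi>"
    and m: "0 < m" "m < \<beta>" "m < \<theta>lo2 (f2 \<alpha>)"
    and f1_lo: "\<And>w. w \<ge> 1 \<Longrightarrow> f1 (m * w) \<ge> c * \<xi> w"
    and u: "incr_from \<alpha> u" "u = forced_profile N h1 \<alpha> a1 f1 v"
    and v: "incr_from \<beta> v" "v = forced_profile N (h_inv \<phi>2) \<beta> a2 f2 u"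
    and r: "0 \<le> r"
  shows "\<alpha> + P_fun N h1 c a1 \<xi> (A_fun N klo2 \<psi>lo2 a2) r \<le> u r"
proof -
  let ?A = "A_fun N klo2 \<psi>lo2 a2"
  have data2: "0 < klo2" "cont_nonneg \<psi>lo2" and gauge2: "gauge_fun (h_inv \<phi>2)"
    using adm2 gauge_fun_h_inv by (auto simp: admissible_phi_def)
  have hc2: "continuous_on {0..} (h_inv \<phi>2)" using gauge2 by (simp add: gauge_fun_def)
  have ac2: "continuous_on {0..} a2" and an2: "\<And>t. 0 \<le> t \<Longrightarrow> 0 \<le> a2 t"
    using a by (auto simp: cont_nonneg_def)
  have A: "0 \<le> ?A t" for t by (rule A_fun_nonneg) (use N data2 a in auto)
  have force2: "cont_nonneg (\<lambda>t. a2 t * f2 (u t))"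
    by (rule cont_nonneg_forcing_incr[OF a(2) f(2) u(1) \<alpha>])
  have v_ge: "m * (1 + ?A t) \<le> v t" if t: "0 \<le> t" for t
  proof -
    have "\<theta>lo2 (f2 \<alpha>) * ?A t = integral {0..t} (\<lambda>s. klo2 * \<theta>lo2 (f2 \<alpha>) * \<psi>lo2 (radial_avg N a2 s))"
      by (simp add: A_fun_def mult_ac)
    also have "\<dots> \<le> integral {0..t} (\<lambda>s. h_inv \<phi>2 (radial_avg N (\<lambda>t. a2 t * f2 (u t)) s))"
    proof (intro integral_le halfline_integrable)
      show "continuous_on {0..} (\<lambda>s. klo2 * \<theta>lo2 (f2 \<alpha>) * \<psi>lo2 (radial_avg N a2 s))"
        by (intro continuous_on_mult_left gauge_radial_avg_continuous N a)
           (use data2 in \<open>simp add: cont_nonneg_def\<close>)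
      show "continuous_on {0..} (\<lambda>s. h_inv \<phi>2 (radial_avg N (\<lambda>t. a2 t * f2 (u t)) s))"
        by (rule gauge_radial_avg_continuous[OF N hc2 force2])
      fix s assume s: "s \<in> {0..t}"
      have "klo2 * \<theta>lo2 (f2 \<alpha>) * \<psi>lo2 (radial_avg N a2 s) \<le> h_inv \<phi>2 (f2 \<alpha> * radial_avg N a2 s)"
        by (rule h_inv_lower[OF adm2 f2_pos radial_avg_nonneg[OF ac2 an2]])
      also have "\<dots> \<le> h_inv \<phi>2 (radial_avg N (\<lambda>t. a2 t * f2 (u t)) s)"
      proof (rule gauge_fun_le[OF gauge2])
        show "0 \<le> f2 \<alpha> * radial_avg N a2 s"
          using f2_pos radial_avg_nonneg[OF ac2 an2] by simp
        have "radial_avg N (\<lambda>t. f2 \<alpha> * a2 t) s \<le> radial_avg N (\<lambda>t. a2 t * f2 (u t)) s"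
        proof (rule radial_avg_mono)
          fix x :: real assume x: "0 \<le> x"
          then have "\<alpha> \<le> u x" using u(1) by (simp add: incr_from_def)
          then have "f2 \<alpha> \<le> f2 (u x)"
            using f \<alpha> by (auto simp: cont_nonneg_incr_def mono_on_def)
          then show "f2 \<alpha> * a2 x \<le> a2 x * f2 (u x)"
            using an2[OF x] by (simp add: mult.commute mult_left_mono)
        next
          show "continuous_on {0..} (\<lambda>t. f2 \<alpha> * a2 t)" by (intro continuous_on_mult_left ac2)
          show "continuous_on {0..} (\<lambda>t. a2 t * f2 (u t))" using force2 by (simp add: cont_nonneg_def)
        qed
        then show "f2 \<alpha> * radial_avg N a2 s \<le> radial_avg N (\<lambda>t. a2 t * f2 (u t)) s"
          by (simp add: radial_avg_cmult)
      qed
      finally show "klo2 * \<theta>lo2 (f2 \<alpha>) * \<psi>lo2 (radial_avg N a2 s)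
          \<le> h_inv \<phi>2 (radial_avg N (\<lambda>t. a2 t * f2 (u t)) s)" .
    qed
    also have "\<beta> + \<dots> = v t"
      using fun_cong[OF v(2), of t] by (simp add: forced_profile_def radial_profile_def)
    finally have "\<beta> + \<theta>lo2 (f2 \<alpha>) * ?A t \<le> v t" by simp
    moreover have "m * ?A t \<le> \<theta>lo2 (f2 \<alpha>) * ?A t"
      using m A[of t] by (intro mult_right_mono) auto
    ultimately show ?thesis using m by (simp add: algebra_simps)
  qed
  have "radial_profile N h1 \<alpha> (\<lambda>t. c * (a1 t * \<xi> (1 + ?A t))) r
      \<le> radial_profile N h1 \<alpha> (\<lambda>t. a1 t * f1 (v t)) r"
  proof (rule radial_profile_mono[OF N h1])
    show "cont_nonneg (\<lambda>t. c * (a1 t * \<xi> (1 + ?A t)))"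
      by (rule cont_nonneg_weight) (use N data2 c \<xi> a in auto)
    show "cont_nonneg (\<lambda>t. a1 t * f1 (v t))"
      by (rule cont_nonneg_forcing_incr[OF a(1) f(1) v(1) \<beta>])
    fix t :: real assume t: "0 \<le> t"
    have "c * \<xi> (1 + ?A t) \<le> f1 (m * (1 + ?A t))" using f1_lo[of "1 + ?A t"] A[of t] by simp
    also have "\<dots> \<le> f1 (v t)"
    proof -
      have "0 \<le> m * (1 + ?A t)" using m A[of t] by simp
      then show ?thesis
        using f(1) v_ge[OF t] by (auto simp: cont_nonneg_incr_def mono_on_def)
    qed
    finally have "a1 t * (c * \<xi> (1 + ?A t)) \<le> a1 t * f1 (v t)"
      by (rule mult_left_mono) (use a t in \<open>simp add: cont_nonneg_def\<close>)
    then show "c * (a1 t * \<xi> (1 + ?A t)) \<le> a1 t * f1 (v t)" by (simp add: mult_ac)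
  qed
  then show ?thesis
    using fun_cong[OF u(2), of r] by (simp add: radial_profile_weight forced_profile_def)
qed

section \<open>Primitives of positive functions and their limits\<close>

lemma at_infty_eq_SUP:
  assumes "mono_on {\<gamma>..} F"
  shows "at_infty F = (SUP r\<in>{\<gamma>..}. ereal (F r))"
  unfolding at_infty_def
proof (rule tendsto_Lim)
  show "((\<lambda>r. ereal (F r)) \<longlongrightarrow> (SUP r\<in>{\<gamma>..}. ereal (F r))) at_top"
  proof (rule increasing_tendsto)
    show "\<forall>\<^sub>F r in at_top. ereal (F r) \<le> (SUP r\<in>{\<gamma>..}. ereal (F r))"
      using eventually_ge_at_top[of \<gamma>] by eventually_elim (auto intro: SUP_upper)
    fix x assume "x < (SUP r\<in>{\<gamma>..}. ereal (F r))"
    then obtain r where r: "\<gamma> \<le> r" "x < ereal (F r)" by (auto simp: less_SUP_iff)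
    show "\<forall>\<^sub>F r in at_top. x < ereal (F r)"
      using eventually_ge_at_top[of r]
    proof eventually_elim
      case (elim s)
      then have "F r \<le> F s" using assms r by (auto simp: mono_on_def)
      then show ?case using r(2) by (meson ereal_less_eq(3) less_le_trans)
    qed
  qed
qed simp

locale positive_primitive =
  fixes \<gamma> :: real and p F :: "real \<Rightarrow> real"
  assumes p_cont: "continuous_on {\<gamma>..} p" and p_pos: "\<And>t. \<gamma> \<le> t \<Longrightarrow> 0 < p t"
    and F_eq: "F = (\<lambda>r. integral {\<gamma>..r} p)"
begin

lemma F_deriv: "\<gamma> \<le> r \<Longrightarrow> (F has_real_derivative p r) (at r within {\<gamma>..})"
  using halfline_integral_deriv[OF p_cont, of r] by (simp add: F_eq)

lemma F_cont: "continuous_on {\<gamma>..} F"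
  using halfline_integral_continuous[OF p_cont] by (simp add: F_eq)

lemma F_start [simp]: "F \<gamma> = 0"
  by (simp add: F_eq)

lemma F_less:
  assumes "\<gamma> \<le> x" "x < y"
  shows "F x < F y"
proof (rule DERIV_pos_imp_increasing_open[OF assms(2)])
  fix t assume "x < t" "t < y"
  then have "\<gamma> < t" using assms by simp
  then show "\<exists>d. (F has_real_derivative d) (at t) \<and> 0 < d"
    using halfline_integral_deriv_interior[OF p_cont] p_pos[of t]
    by (intro exI[of _ "p t"]) (simp add: F_eq)
qed (use assms in \<open>auto intro: continuous_on_subset[OF F_cont]\<close>)

lemma F_le: "\<gamma> \<le> x \<Longrightarrow> x \<le> y \<Longrightarrow> F x \<le> F y"
  using F_less[of x y] by (cases "x = y") auto

lemma at_infty_F: "at_infty F = (SUP r\<in>{\<gamma>..}. ereal (F r))"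
  by (rule at_infty_eq_SUP) (auto simp: mono_on_def intro: F_le)

lemma exceeds:
  assumes "ereal y < at_infty F"
  obtains z where "\<gamma> \<le> z" "y < F z"
  using assms by (auto simp: at_infty_F less_SUP_iff)

lemma le_inverse:
  assumes y: "0 \<le> y" "ereal y < at_infty F" and x: "\<gamma> \<le> x" "F x \<le> y"
  shows "x \<le> the_inv_into {\<gamma>..} F y"
proof -
  obtain z where z: "\<gamma> \<le> z" "y < F z" using exceeds[OF y(2)] .
  have "continuous_on {\<gamma>..z} F" by (rule continuous_on_subset[OF F_cont]) auto
  then obtain w where w: "\<gamma> \<le> w" "F w = y"
    using IVT'[of F \<gamma> y z] y z by auto
  have "inj_on F {\<gamma>..}"
    by (rule strict_mono_on_imp_inj_on) (simp add: strict_mono_on_def F_less)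
  then have "the_inv_into {\<gamma>..} F y = w"
    using the_inv_into_f_f[of F "{\<gamma>..}" w] w by simp
  moreover have "x \<le> w"
    using F_less[of w x] w x by (cases "x \<le> w") auto
  ultimately show ?thesis by simp
qed

text \<open>A constant integrand would make \<open>F\<close> grow linearly.\<close>

lemma nonconstant:
  assumes "at_infty F < \<infinity>"
  shows "\<exists>t\<ge>\<gamma>. p t \<noteq> p \<gamma>"
proof (rule ccontr)
  assume "\<not> (\<exists>t\<ge>\<gamma>. p t \<noteq> p \<gamma>)"
  then have const: "p t = p \<gamma>" if "\<gamma> \<le> t" for t using that by blast
  have "ereal (F \<gamma>) \<le> at_infty F" unfolding at_infty_F by (rule SUP_upper) simp
  then obtain L where L: "at_infty F = ereal L" "0 \<le> L"
    using assms by (cases "at_infty F") auto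
  let ?z = "\<gamma> + (L + 1) / p \<gamma>"
  have z: "\<gamma> \<le> ?z" using L p_pos[of \<gamma>] by simp
  have "F ?z = integral {\<gamma>..?z} (\<lambda>_. p \<gamma>)"
    unfolding F_eq by (rule Henstock_Kurzweil_Integration.integral_cong, rule const) simp
  also have "\<dots> = L + 1" using z p_pos[of \<gamma>] by simp
  finally have "ereal (L + 1) \<le> at_infty F"
    unfolding at_infty_F using z SUP_upper[of ?z "{\<gamma>..}" "\<lambda>r. ereal (F r)"] by simp
  then show False using L by simp
qed

end

section \<open>Upper bounds for one component\<close>

text \<open>The hypotheses behind the upper bound for the first component. Exchanging the two equations
  turns them into those for the second component, so that everything below serves twice.\<close>

locale coupled_estimate =
  fixes N :: nat and \<alpha> \<beta> :: real
    and \<phi>1 \<phi>2 \<theta>lo1 \<theta>up1 \<psi>lo1 \<psi>up1 \<theta>lo2 \<theta>up2 \<psi>lo2 \<psi>up2 :: "real \<Rightarrow> real"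
    and klo1 kup1 klo2 kup2 :: real
    and a1 a2 f1 f2 g \<xi> :: "real \<Rightarrow> real" and M c :: real
  assumes N2: "2 \<le> N" and \<alpha>: "0 < \<alpha>" and \<beta>: "0 < \<beta>"
    and adm1: "admissible_phi \<phi>1 klo1 kup1 \<theta>lo1 \<theta>up1 \<psi>lo1 \<psi>up1"
    and adm2: "admissible_phi \<phi>2 klo2 kup2 \<theta>lo2 \<theta>up2 \<psi>lo2 \<psi>up2"
    and a1: "cont_nonneg a1" and a2: "cont_nonneg a2"
    and f1: "cont_nonneg_incr f1" and f2: "cont_nonneg_incr f2"
    and f1_pos: "\<And>s. 0 < s \<Longrightarrow> 0 < f1 s" and f2_pos: "\<And>s. 0 < s \<Longrightarrow> 0 < f2 s"
    and M: "max 1 (\<beta> / \<theta>up2 (f2 \<alpha>)) \<le> M" and c: "0 < c"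
    and g: "cont_nonneg_incr g" and \<xi>: "cont_nonneg \<xi>"
    and f1_up: "\<And>t w. 1 \<le> w \<Longrightarrow> M * \<theta>up2 (f2 \<alpha>) \<le> t \<Longrightarrow> f1 (t * w) \<le> c * g t * \<xi> w"
begin

abbreviation "A \<equiv> A_fun N kup2 \<psi>up2 a2"
abbreviation "P \<equiv> P_fun N \<psi>up1 c a1 \<xi> A"
abbreviation "H \<equiv> H_fun \<alpha> \<theta>up1 g M \<theta>up2 f2"
abbreviation "G t \<equiv> g (M * \<theta>up2 (f2 t))"
abbreviation "T1 \<equiv> forced_profile N (h_inv \<phi>1) \<alpha> a1 f1"
abbreviation "T2 \<equiv> forced_profile N (h_inv \<phi>2) \<beta> a2 f2"
abbreviation "q r \<equiv> radial_avg N (\<lambda>t. c * (a1 t * \<xi> (1 + A t))) r"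

lemma N: "1 \<le> N" using N2 by simp

lemma gauge1: "gauge_fun (h_inv \<phi>1)" and gauge2: "gauge_fun (h_inv \<phi>2)"
  by (rule gauge_fun_h_inv[OF adm1], rule gauge_fun_h_inv[OF adm2])

lemma k_pos: "0 < kup1" "0 < kup2"
  and theta: "cont_nonneg_incr \<theta>up1" "cont_nonneg_incr \<theta>up2"
  and psi: "cont_nonneg \<psi>up1" "cont_nonneg \<psi>up2"
  using adm1 adm2 by (simp_all add: admissible_phi_def)

lemma incr_le: "cont_nonneg_incr f \<Longrightarrow> 0 \<le> x \<Longrightarrow> x \<le> y \<Longrightarrow> f x \<le> f y"
  by (auto simp: cont_nonneg_incr_def mono_on_def)

lemma incr_nonneg: "cont_nonneg_incr f \<Longrightarrow> 0 \<le> x \<Longrightarrow> 0 \<le> f x"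
  by (simp add: cont_nonneg_incr_def cont_nonneg_def)

lemma M_ge_1: "1 \<le> M" using M by simp

lemma theta_f_pos: "0 < s \<Longrightarrow> 0 < \<theta>up2 (f2 s)"
  by (rule theta_up_pos[OF adm2 f2_pos])

lemma initial_value_absorbed: "\<beta> \<le> M * \<theta>up2 (f2 \<alpha>)"
  using M theta_f_pos[OF \<alpha>] by (simp add: pos_divide_le_eq)

lemma arg_le:
  assumes "0 < s" "s \<le> t"
  shows "M * \<theta>up2 (f2 s) \<le> M * \<theta>up2 (f2 t)"
  using assms M_ge_1 incr_le[OF f2, of s t] incr_le[OF theta(2)] f2_pos[of s]
  by (intro mult_left_mono) auto

lemma arg_pos: "0 < s \<Longrightarrow> 0 < M * \<theta>up2 (f2 s)"
  using theta_f_pos M_ge_1 by simp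

lemma G_le: "0 < s \<Longrightarrow> s \<le> t \<Longrightarrow> G s \<le> G t"
  using arg_le[of s t] arg_pos[of s] incr_le[OF g] by auto

lemma g_\<xi>_pos:
  assumes "\<alpha> \<le> t" "1 \<le> w"
  shows "0 < G t" and "0 < \<xi> w"
proof -
  let ?x = "M * \<theta>up2 (f2 t)"
  have x: "0 < ?x" "M * \<theta>up2 (f2 \<alpha>) \<le> ?x"
    using assms \<alpha> arg_pos[of t] arg_le[of \<alpha> t] by auto
  have "0 < f1 (?x * w)" using x assms by (intro f1_pos) simp
  also have "\<dots> \<le> c * g ?x * \<xi> w" by (rule f1_up[OF assms(2) x(2)])
  finally have pos: "0 < c * g ?x * \<xi> w" .
  have nn: "0 \<le> g ?x" "0 \<le> \<xi> w"
    using incr_nonneg[OF g, of ?x] x \<xi> assms by (auto simp: cont_nonneg_def)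
  then show "0 < G t" "0 < \<xi> w"
    using pos by (auto simp: less_le)
qed

lemma G_pos: "\<alpha> \<le> t \<Longrightarrow> 0 < G t"
  by (rule g_\<xi>_pos(1)[of t 1]) simp_all

lemma G_cont: "continuous_on {\<alpha>..} G"
proof -
  have f2_nn: "f2 ` {\<alpha>..} \<subseteq> {0..}"
    using incr_nonneg[OF f2] \<alpha> by (meson atLeast_iff image_subsetI less_le_trans less_imp_le)
  have arg_nn: "(\<lambda>t. M * \<theta>up2 (f2 t)) ` {\<alpha>..} \<subseteq> {0..}"
    using arg_pos \<alpha> by (meson atLeast_iff image_subsetI less_le_trans less_imp_le)
  have f2_cont: "continuous_on {\<alpha>..} f2"
    by (rule continuous_on_subset[of "{0..}"])
       (use f2 \<alpha> in \<open>simp_all add: cont_nonneg_incr_def cont_nonneg_def\<close>)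
  have \<theta>_cont: "continuous_on {0..} \<theta>up2" and g_cont: "continuous_on {0..} g"
    using theta(2) g by (simp_all add: cont_nonneg_incr_def cont_nonneg_def)
  show ?thesis
    by (intro continuous_on_compose2[OF g_cont _ arg_nn] continuous_on_mult_left
          continuous_on_compose2[OF \<theta>_cont f2_cont f2_nn])
qed

sublocale H: positive_primitive \<alpha> "\<lambda>t. 1 / \<theta>up1 (G t)" H
proof
  have G_nn: "G ` {\<alpha>..} \<subseteq> {0..}"
    using G_pos by (meson atLeast_iff image_subsetI less_imp_le)
  have \<theta>_cont: "continuous_on {0..} \<theta>up1"
    using theta by (simp add: cont_nonneg_incr_def cont_nonneg_def)
  have \<theta>_pos: "0 < \<theta>up1 (G t)" if "\<alpha> \<le> t" for t
    by (rule theta_up_pos[OF adm1 G_pos[OF that]])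
  show "continuous_on {\<alpha>..} (\<lambda>t. 1 / \<theta>up1 (G t))"
    by (intro continuous_on_divide continuous_on_const continuous_on_compose2[OF \<theta>_cont G_cont G_nn])
       (metis \<theta>_pos atLeast_iff less_irrefl)
  show "0 < 1 / \<theta>up1 (G t)" if "\<alpha> \<le> t" for t
    using \<theta>_pos[OF that] by simp
qed (simp add: H_fun_def[abs_def])

lemma A_nonneg: "0 \<le> A t"
  by (rule A_fun_nonneg) (use N k_pos psi a2 in auto)

lemma weight: "cont_nonneg (\<lambda>t. c * (a1 t * \<xi> (1 + A t)))"
  by (rule cont_nonneg_weight) (use N k_pos c psi \<xi> a1 a2 in auto)

lemma q_nonneg: "0 \<le> q r"
  using weight by (intro radial_avg_nonneg) (auto simp: cont_nonneg_def)

lemma P_deriv: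
  assumes "0 \<le> r"
  shows "(P has_real_derivative \<psi>up1 (q r)) (at r within {0..})"
proof -
  have "continuous_on {0..} \<psi>up1" using psi by (simp add: cont_nonneg_def)
  from radial_profile_deriv[OF N this weight assms, of 0] show ?thesis
    by (simp add: radial_profile_weight[abs_def])
qed

lemma P_0: "P 0 = 0"
  by (simp add: P_fun_def)

end

text \<open>A pair of profiles as produced by the iteration: the first equation holds, the second one
  as an inequality.\<close>

locale subsolution_pair = coupled_estimate +
  fixes u v :: "real \<Rightarrow> real"
  assumes u: "incr_from \<alpha> u" and v: "incr_from \<beta> v"
    and u_eq: "u = T1 v" and v_le: "\<And>t. 0 \<le> t \<Longrightarrow> v t \<le> T2 u t"
begin

lemma u_ge: "0 \<le> t \<Longrightarrow> \<alpha> \<le> u t" and u_mono: "0 \<le> s \<Longrightarrow> s \<le> t \<Longrightarrow> u s \<le> u t"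
  and v_ge: "0 \<le> t \<Longrightarrow> \<beta> \<le> v t"
  using u v by (auto simp: incr_from_def mono_on_def)

lemma force1: "cont_nonneg (\<lambda>t. a1 t * f1 (v t))"
  by (rule cont_nonneg_forcing_incr[OF a1 f1 v \<beta>])

lemma force2: "cont_nonneg (\<lambda>t. a2 t * f2 (u t))"
  by (rule cont_nonneg_forcing_incr[OF a2 f2 u \<alpha>])

text \<open>Replacing \<open>u s\<close> for \<open>s \<le> t\<close> by \<open>u t\<close> takes the nonlinearity out of the average. The initial
  value \<open>\<beta>\<close> is absorbed because \<open>M\<close> is large. The factor \<open>1 + A t\<close> is at least 1, which is what the
  splitting of \<open>f1\<close> asks of its second argument.\<close>

lemma v_bound:
  assumes t: "0 \<le> t"
  shows "v t \<le> M * \<theta>up2 (f2 (u t)) * (1 + A t)"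
proof -
  have ut: "\<alpha> \<le> u t" "0 < u t" using u_ge[OF t] \<alpha> by auto
  have ac2: "continuous_on {0..} a2" and an2: "\<And>t. 0 \<le> t \<Longrightarrow> 0 \<le> a2 t"
    using a2 by (auto simp: cont_nonneg_def)
  have hc: "continuous_on {0..} (h_inv \<phi>2)" using gauge2 by (simp add: gauge_fun_def)
  let ?\<theta> = "\<theta>up2 (f2 (u t))"
  have "integral {0..t} (\<lambda>s. h_inv \<phi>2 (radial_avg N (\<lambda>t. a2 t * f2 (u t)) s))
      \<le> integral {0..t} (\<lambda>s. kup2 * ?\<theta> * \<psi>up2 (radial_avg N a2 s))"
  proof (intro integral_le halfline_integrable)
    show "continuous_on {0..} (\<lambda>s. kup2 * ?\<theta> * \<psi>up2 (radial_avg N a2 s))"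
      by (intro continuous_on_mult_left gauge_radial_avg_continuous N a2)
         (use psi in \<open>simp add: cont_nonneg_def\<close>)
    show "continuous_on {0..} (\<lambda>s. h_inv \<phi>2 (radial_avg N (\<lambda>t. a2 t * f2 (u t)) s))"
      by (rule gauge_radial_avg_continuous[OF N hc force2])
    fix s assume s: "s \<in> {0..t}"
    have "radial_avg N (\<lambda>t. a2 t * f2 (u t)) s \<le> radial_avg N (\<lambda>x. f2 (u t) * a2 x) s"
    proof (rule radial_avg_mono)
      show "continuous_on {0..} (\<lambda>t. a2 t * f2 (u t))" using force2 by (simp add: cont_nonneg_def)
      show "continuous_on {0..} (\<lambda>x. f2 (u t) * a2 x)" by (intro continuous_on_mult_left ac2)
      fix x assume x: "0 \<le> x" "x \<le> s"
      have "0 \<le> u x" "u x \<le> u t" using u_ge[of x] \<alpha> u_mono[of x t] x s by auto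
      then show "a2 x * f2 (u x) \<le> f2 (u t) * a2 x"
        using an2[OF x(1)] incr_le[OF f2] by (simp add: mult.commute mult_left_mono)
    qed
    moreover have "0 \<le> radial_avg N (\<lambda>t. a2 t * f2 (u t)) s"
      using force2 by (intro radial_avg_nonneg) (auto simp: cont_nonneg_def)
    ultimately have "h_inv \<phi>2 (radial_avg N (\<lambda>t. a2 t * f2 (u t)) s)
        \<le> h_inv \<phi>2 (f2 (u t) * radial_avg N a2 s)"
      by (intro gauge_fun_le[OF gauge2]) (simp_all add: radial_avg_cmult)
    also have "\<dots> \<le> kup2 * ?\<theta> * \<psi>up2 (radial_avg N a2 s)"
      by (rule h_inv_upper[OF adm2 f2_pos[OF ut(2)] radial_avg_nonneg[OF ac2 an2]])
    finally show "h_inv \<phi>2 (radial_avg N (\<lambda>t. a2 t * f2 (u t)) s)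
        \<le> kup2 * ?\<theta> * \<psi>up2 (radial_avg N a2 s)" .
  qed
  also have "\<dots> = ?\<theta> * A t" by (simp add: A_fun_def mult_ac)
  finally have "v t \<le> \<beta> + ?\<theta> * A t"
    using v_le[OF t] by (simp add: forced_profile_def radial_profile_def)
  also have "\<dots> \<le> M * ?\<theta> + (M * ?\<theta>) * A t"
  proof (intro add_mono mult_right_mono A_nonneg)
    show "\<beta> \<le> M * ?\<theta>" using initial_value_absorbed arg_le[OF \<alpha> ut(1)] by simp
    show "?\<theta> \<le> M * ?\<theta>" using M_ge_1 theta_f_pos[OF ut(2)] by simp
  qed
  finally show ?thesis by (simp add: algebra_simps)
qed

text \<open>The threshold \<open>M * \<theta>up2 (f2 \<alpha>)\<close> in the splitting of \<open>f1\<close> is met because \<open>u\<close> starts at \<open>\<alpha>\<close> and does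
  not decrease.\<close>

lemma forcing_bound:
  assumes t: "0 \<le> t"
  shows "f1 (v t) \<le> G (u t) * (c * \<xi> (1 + A t))"
proof -
  have "f1 (v t) \<le> f1 (M * \<theta>up2 (f2 (u t)) * (1 + A t))"
    by (rule incr_le[OF f1 _ v_bound[OF t]]) (use v_ge[OF t] \<beta> in simp)
  also have "\<dots> \<le> c * G (u t) * \<xi> (1 + A t)"
    by (rule f1_up) (use A_nonneg arg_le[OF \<alpha> u_ge[OF t]] in auto)
  finally show ?thesis by (simp add: mult_ac)
qed

lemma forcing_bound_later:
  assumes "0 \<le> t" "t \<le> r"
  shows "a1 t * f1 (v t) \<le> G (u r) * (c * (a1 t * \<xi> (1 + A t)))"
proof -
  have "0 < u t" using u_ge[OF assms(1)] \<alpha> by simp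
  then have "G (u t) \<le> G (u r)" by (rule G_le) (rule u_mono[OF assms])
  then have "f1 (v t) \<le> G (u r) * (c * \<xi> (1 + A t))"
    using forcing_bound[OF assms(1)] c g_\<xi>_pos(2)[OF order_refl, of "1 + A t"] A_nonneg[of t]
    by (smt (verit) mult_nonneg_nonneg mult_right_mono)
  then have "a1 t * f1 (v t) \<le> a1 t * (G (u r) * (c * \<xi> (1 + A t)))"
    by (rule mult_left_mono) (use a1 assms in \<open>simp add: cont_nonneg_def\<close>)
  then show ?thesis by (simp add: mult_ac)
qed

lemma avg_bound: "radial_avg N (\<lambda>t. a1 t * f1 (v t)) r \<le> G (u r) * q r"
proof -
  have "radial_avg N (\<lambda>t. a1 t * f1 (v t)) r
      \<le> radial_avg N (\<lambda>t. G (u r) * (c * (a1 t * \<xi> (1 + A t)))) r"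
  proof (rule radial_avg_mono)
    show "continuous_on {0..} (\<lambda>t. a1 t * f1 (v t))" using force1 by (simp add: cont_nonneg_def)
    show "continuous_on {0..} (\<lambda>t. G (u r) * (c * (a1 t * \<xi> (1 + A t))))"
      by (rule continuous_on_mult_left) (use weight in \<open>simp add: cont_nonneg_def\<close>)
  qed (rule forcing_bound_later)
  then show ?thesis by (simp only: radial_avg_cmult)
qed

lemma avg_nonneg: "0 \<le> radial_avg N (\<lambda>t. a1 t * f1 (v t)) r"
  using force1 by (intro radial_avg_nonneg) (auto simp: cont_nonneg_def)

abbreviation "slope r \<equiv> h_inv \<phi>1 (radial_avg N (\<lambda>t. a1 t * f1 (v t)) r)"

lemma slope_bound:
  assumes "0 \<le> r"
  shows "h_inv \<phi>1 (G (u r) * q r) \<le> kup1 * \<theta>up1 (G (u r)) * \<psi>up1 (q r)"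
  by (rule h_inv_upper[OF adm1 G_pos[OF u_ge[OF assms]] q_nonneg])

text \<open>The separated form of the differential inequality: the gap \<open>kup1 * P - H \<circ> u\<close> starts at 0
  and never decreases.\<close>

lemma gap_deriv:
  assumes r: "0 \<le> r"
  shows "((\<lambda>r. kup1 * P r - H (u r)) has_real_derivative
    kup1 * \<psi>up1 (q r) - slope r / \<theta>up1 (G (u r))) (at r within {0..})"
proof -
  have hc: "continuous_on {0..} (h_inv \<phi>1)" using gauge1 by (simp add: gauge_fun_def)
  have "(u has_real_derivative slope r) (at r within {0..})"
    using radial_profile_deriv[OF N hc force1 r, of \<alpha>] by (subst u_eq) (simp add: forced_profile_def[abs_def])
  moreover have "(H has_real_derivative 1 / \<theta>up1 (G (u r))) (at (u r) within u ` {0..})"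
    by (rule has_field_derivative_subset[OF H.F_deriv[OF u_ge[OF r]]]) (use u_ge in auto)
  ultimately have "(H \<circ> u has_real_derivative 1 / \<theta>up1 (G (u r)) * slope r) (at r within {0..})"
    by (intro DERIV_image_chain)
  then show ?thesis
    using DERIV_diff[OF DERIV_cmult[OF P_deriv[OF r], of kup1]] by (simp add: o_def)
qed

lemma gap_deriv_nonneg:
  assumes r: "0 \<le> r"
  shows "0 \<le> kup1 * \<psi>up1 (q r) - slope r / \<theta>up1 (G (u r))"
proof -
  have "slope r \<le> h_inv \<phi>1 (G (u r) * q r)"
    by (rule gauge_fun_le[OF gauge1 avg_nonneg avg_bound])
  also note slope_bound[OF r]
  finally show ?thesis
    using theta_up_pos[OF adm1 G_pos[OF u_ge[OF r]]] by (simp add: pos_divide_le_eq mult_ac)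
qed

lemma gap_mono:
  assumes rs: "0 \<le> r" "r \<le> s"
  shows "kup1 * P r - H (u r) \<le> kup1 * P s - H (u s)"
proof (rule DERIV_nonneg_imp_increasing_open[OF rs(2)])
  show "continuous_on {r..s} (\<lambda>r. kup1 * P r - H (u r))"
    by (rule continuous_on_subset[OF DERIV_continuous_on[OF gap_deriv]]) (use rs in auto)
  fix x assume "r < x" "x < s"
  then have x: "0 < x" using rs by simp
  then have "at x within {0..} = at x" by (intro at_within_interior) simp
  then show "\<exists>d. ((\<lambda>r. kup1 * P r - H (u r)) has_real_derivative d) (at x) \<and> 0 \<le> d"
    using gap_deriv[of x] gap_deriv_nonneg[of x] x by auto
qed

lemma u_0: "u 0 = \<alpha>"
  by (subst u_eq) (simp add: forced_profile_def)

lemma H_bound: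
  assumes "0 \<le> r"
  shows "H (u r) \<le> kup1 * P r"
  using gap_mono[OF order_refl assms] by (simp add: u_0 P_0)

lemma upper_bound:
  assumes r: "0 \<le> r" and dom: "ereal (kup1 * P r) < at_infty H"
  shows "u r \<le> the_inv_into {\<alpha>..} H (kup1 * P r)"
proof (rule H.le_inverse[OF _ dom u_ge[OF r] H_bound[OF r]])
  show "0 \<le> kup1 * P r"
    using H_bound[OF r] H.F_le[OF order_refl u_ge[OF r]] H.F_start by linarith
qed

text \<open>Where the first component has moved away from \<open>\<alpha>\<close>, some earlier point carries a positive
  weight. As soon as \<open>G \<circ> u\<close> has grown beyond its value at that point, replacing \<open>u t\<close> by \<open>u r\<close>
  in the average loses a positive amount.\<close>

lemma gap_deriv_pos:
  assumes s: "0 \<le> s" "s \<le> r" "u s \<noteq> \<alpha>" and G: "G (u s) < G (u r)"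
  shows "0 < r" and "0 < kup1 * \<psi>up1 (q r) - slope r / \<theta>up1 (G (u r))"
proof -
  have "\<exists>t. 0 < t \<and> t \<le> s \<and> 0 < a1 t"
  proof (rule ccontr)
    assume no: "\<not> (\<exists>t. 0 < t \<and> t \<le> s \<and> 0 < a1 t)"
    \<comment> \<open>\<open>a1 0\<close> may be positive; the factor \<open>z ^ (N - 1)\<close> takes care of it\<close>
    have a0: "z ^ (N - 1) * (a1 z * f1 (v z)) = 0" if "0 \<le> z" "z \<le> s" for z
    proof (cases "z = 0")
      case True then show ?thesis using N2 by simp
    next
      case False
      then have "a1 z = 0" using no a1 that by (force simp: cont_nonneg_def)
      then show ?thesis by simp
    qed
    have "radial_avg N (\<lambda>t. a1 t * f1 (v t)) x = 0" if "0 \<le> x" "x \<le> s" for x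
    proof -
      have "integral {0..x} (\<lambda>z. z ^ (N - 1) * (a1 z * f1 (v z))) = integral {0..x} (\<lambda>_. 0)"
        by (rule Henstock_Kurzweil_Integration.integral_cong) (use a0 that in auto)
      then show ?thesis by (simp add: radial_avg_def)
    qed
    then have "integral {0..s} slope = integral {0..s} (\<lambda>_. 0)"
      by (intro Henstock_Kurzweil_Integration.integral_cong) (simp add: h_inv_def)
    then have "u s = \<alpha>"
      using fun_cong[OF u_eq, of s] by (simp add: forced_profile_def radial_profile_def)
    with s show False by simp
  qed
  then obtain t where t: "0 < t" "t \<le> s" "0 < a1 t" by blast
  show r: "0 < r" using t s by simp
  let ?b = "\<lambda>x. G (u r) * (c * (a1 x * \<xi> (1 + A x)))" and ?f = "\<lambda>x. a1 x * f1 (v x)"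
  have cont: "continuous_on {0..} ?b" "continuous_on {0..} ?f"
    by (rule continuous_on_mult_left) (use weight force1 in \<open>simp_all add: cont_nonneg_def\<close>)
  have "0 < radial_avg N (\<lambda>x. ?b x - ?f x) r"
  proof (rule radial_avg_pos[OF N])
    show "continuous_on {0..} (\<lambda>x. ?b x - ?f x)" by (intro continuous_on_diff cont)
    show "0 \<le> ?b x - ?f x" if "0 \<le> x" "x \<le> r" for x
      using forcing_bound_later[OF that] by simp
    show "0 < t" "t \<le> r" using t s by auto
    have "0 < u t" using u_ge[of t] t \<alpha> by simp
    then have "G (u t) < G (u r)" using G_le[of "u t" "u s"] u_mono[of t s] t G by simp
    moreover have "0 < c * (a1 t * \<xi> (1 + A t))"
      using c t g_\<xi>_pos(2)[OF order_refl, of "1 + A t"] A_nonneg[of t] by simp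
    ultimately have "G (u t) * (c * (a1 t * \<xi> (1 + A t))) < ?b t" by (rule mult_strict_right_mono)
    moreover have "?f t \<le> G (u t) * (c * (a1 t * \<xi> (1 + A t)))"
      by (rule forcing_bound_later) (use t in simp_all)
    ultimately show "0 < ?b t - ?f t" by linarith
  qed
  then have "radial_avg N ?f r < G (u r) * q r"
    by (simp only: radial_avg_diff[OF cont] radial_avg_cmult diff_gt_0_iff_gt)
  then have "slope r < h_inv \<phi>1 (G (u r) * q r)"
    by (rule gauge_fun_less[OF gauge1 avg_nonneg])
  also have "\<dots> \<le> kup1 * \<theta>up1 (G (u r)) * \<psi>up1 (q r)" by (rule slope_bound) (use r in simp)
  finally show "0 < kup1 * \<psi>up1 (q r) - slope r / \<theta>up1 (G (u r))"
    using theta_up_pos[OF adm1 G_pos[OF u_ge[of r]]] r by (simp add: pos_divide_less_eq mult_ac)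
qed

text \<open>Since \<open>kup1 * P\<close> may tend to the limit of \<open>H\<close>, the bound by the inverse function alone does
  not exclude that \<open>u\<close> is unbounded. But the limit of \<open>H\<close> is finite, so \<open>G\<close> is not constant, and an
  unbounded \<open>u\<close> would make the gap positive at some radius; from there on \<open>H \<circ> u\<close> would stay a fixed
  amount below the limit of \<open>H\<close>, which bounds \<open>u\<close> after all.\<close>

lemma bounded_above:
  assumes fin: "at_infty H < \<infinity>" and dom: "\<And>r. 0 \<le> r \<Longrightarrow> ereal (kup1 * P r) < at_infty H"
  shows "\<exists>C. \<forall>r\<ge>0. u r \<le> C"
proof (rule ccontr)
  assume "\<not> ?thesis"
  then have unb: "\<exists>r\<ge>0. C < u r" for C by (meson not_le)
  obtain z where z: "\<alpha> \<le> z" "1 / \<theta>up1 (G z) \<noteq> 1 / \<theta>up1 (G \<alpha>)" using H.nonconstant[OF fin] by blast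
  then have "G \<alpha> < G z" using G_le[OF \<alpha> z(1)] by (cases "G z = G \<alpha>") auto
  moreover obtain r1 where r1: "0 \<le> r1" "z < u r1" using unb[of z] by blast
  moreover have "G z \<le> G (u r1)" by (rule G_le) (use r1 z \<alpha> in auto)
  ultimately have G: "G \<alpha> < G (u r1)" by simp
  have "continuous_on {0..r1} u"
    using u by (auto simp: incr_from_def intro: continuous_on_subset)
  then have Gu: "continuous_on {0..r1} (\<lambda>r. G (u r))"
    by (rule continuous_on_compose2[OF G_cont]) (use u_ge in auto)
  \<comment> \<open>an intermediate value: different from \<open>G \<alpha>\<close>, so that \<open>u s\<close> has left \<open>\<alpha>\<close>, and still below
      \<open>G (u r1)\<close>\<close>
  obtain s where s: "0 \<le> s" "s \<le> r1" "G (u s) = (G \<alpha> + G (u r1)) / 2"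
    using IVT'[of "\<lambda>r. G (u r)" 0 "(G \<alpha> + G (u r1)) / 2" r1] Gu G r1(1) by (auto simp: u_0)
  have "u s \<noteq> \<alpha>" "G (u s) < G (u r1)" using s(3) G by auto
  note pos = gap_deriv_pos[OF s(1,2) this]
  define gap where "gap = (\<lambda>r. kup1 * P r - H (u r))"
  have "at r1 within {0..} = at r1" by (intro at_within_interior) (use pos(1) in simp)
  then have "DERIV gap r1 :> kup1 * \<psi>up1 (q r1) - slope r1 / \<theta>up1 (G (u r1))"
    using gap_deriv[OF r1(1)] by (simp add: gap_def)
  from DERIV_pos_inc_right[OF this pos(2)] obtain d where
    d: "0 < d" "\<forall>h>0. h < d \<longrightarrow> gap r1 < gap (r1 + h)" by blast
  define r2 where "r2 = r1 + d / 2"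
  have r2: "0 \<le> r2" "gap r1 < gap r2" using d r1 by (auto simp: r2_def)
  have \<delta>: "0 < gap r2" using H_bound[OF r1(1)] r2 by (simp add: gap_def)
  have "ereal (kup1 * P 0) < at_infty H" by (rule dom) simp
  then obtain L where L: "at_infty H = ereal L" using fin by (cases "at_infty H") auto
  have "ereal (L - gap r2) < at_infty H" using L \<delta> by simp
  then obtain y where y: "\<alpha> \<le> y" "L - gap r2 < H y" by (rule H.exceeds)
  obtain r3 where r3: "0 \<le> r3" "max y (u r2) < u r3" using unb[of "max y (u r2)"] by blast
  then have "r2 \<le> r3" using u_mono[of r3 r2] by force
  then have "gap r2 \<le> gap r3" using gap_mono[OF r2(1)] by (simp add: gap_def)
  moreover have "kup1 * P r3 < L" using dom[OF r3(1)] L by simp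
  ultimately have "H (u r3) < H y" using y by (simp add: gap_def)
  moreover have "H y \<le> H (u r3)" by (rule H.F_le) (use y r3 in auto)
  ultimately show False by simp
qed

end

section \<open>Existence of the bounded solution\<close>

theorem theorem2p4:
  fixes N :: nat and \<alpha> \<beta> :: real
    and \<phi>1 \<phi>2 \<theta>lo1 \<theta>up1 \<theta>lo2 \<theta>up2 \<psi>lo1 \<psi>up1 \<psi>lo2 \<psi>up2 :: "real \<Rightarrow> real"
    and klo1 kup1 klo2 kup2 :: real
    and a1 a2 f1 f2 g1 g2 \<xi>up1 \<xi>up2 \<xi>lo1 \<xi>lo2 :: "real \<Rightarrow> real"
    and M1 M2 cup1 cup2 clo1 clo2 m1 m2 :: real
  defines "Aup1 \<equiv> A_fun N kup1 \<psi>up1 a1"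
    and "Aup2 \<equiv> A_fun N kup2 \<psi>up2 a2"
    and "Alo1 \<equiv> A_fun N klo1 \<psi>lo1 a1"
    and "Alo2 \<equiv> A_fun N klo2 \<psi>lo2 a2"
  defines "Pup12 \<equiv> P_fun N \<psi>up1 cup1 a1 \<xi>up1 Aup2"
    and "Pup21 \<equiv> P_fun N \<psi>up2 cup2 a2 \<xi>up2 Aup1"
    and "Plo12 \<equiv> P_fun N (h_inv \<phi>1) clo1 a1 \<xi>lo1 Alo2"
    and "Plo21 \<equiv> P_fun N (h_inv \<phi>2) clo2 a2 \<xi>lo2 Alo1"
    and "H12 \<equiv> H_fun \<alpha> \<theta>up1 g1 M1 \<theta>up2 f2"
    and "H21 \<equiv> H_fun \<beta> \<theta>up2 g2 M2 \<theta>up1 f1"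
  assumes N: "N \<ge> 3" "CARD('n::finite) = N"
    and pos: "\<alpha> > 0" "\<beta> > 0"
    and phi1: "admissible_phi \<phi>1 klo1 kup1 \<theta>lo1 \<theta>up1 \<psi>lo1 \<psi>up1"
    and phi2: "admissible_phi \<phi>2 klo2 kup2 \<theta>lo2 \<theta>up2 \<psi>lo2 \<psi>up2"
    and a: "cont_nonneg a1" "cont_nonneg a2"
    and f: "cont_nonneg_incr f1" "cont_nonneg_incr f2"
    and f0: "f1 0 * f2 0 \<ge> 0"
    and f_pos: "\<And>s1 s2. s1 > 0 \<Longrightarrow> s2 > 0 \<Longrightarrow> f1 s1 * f2 s2 > 0"
    and M1: "M1 \<ge> max 1 (\<beta> / \<theta>up2 (f2 \<alpha>))"
    and M2: "M2 \<ge> max 1 (\<alpha> / \<theta>up1 (f1 \<beta>))"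
    and cup: "cup1 > 0" "cup2 > 0"
    and g: "cont_nonneg_incr g1" "cont_nonneg_incr g2"
    and xi_up: "cont_nonneg \<xi>up1" "cont_nonneg \<xi>up2"
    and f1_up: "\<And>t w. w \<ge> 1 \<Longrightarrow> t \<ge> M1 * \<theta>up2 (f2 \<alpha>) \<Longrightarrow> f1 (t * w) \<le> cup1 * g1 t * \<xi>up1 w"
    and f2_up: "\<And>t w. w \<ge> 1 \<Longrightarrow> t \<ge> M2 * \<theta>up1 (f1 \<beta>) \<Longrightarrow> f2 (t * w) \<le> cup2 * g2 t * \<xi>up2 w"
    and clo: "clo1 > 0" "clo2 > 0"
    and xi_lo: "cont_nonneg \<xi>lo1" "cont_nonneg \<xi>lo2"
    and m1: "m1 \<in> {0<..<min \<beta> (\<theta>lo2 (f2 \<alpha>))}"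
    and m2: "m2 \<in> {0<..<min \<alpha> (\<theta>lo1 (f1 \<beta>))}"
    and f1_lo: "\<And>w. w \<ge> 1 \<Longrightarrow> f1 (m1 * w) \<ge> clo1 * \<xi>lo1 w"
    and f2_lo: "\<And>w. w \<ge> 1 \<Longrightarrow> f2 (m2 * w) \<ge> clo2 * \<xi>lo2 w"
    and KO12: "at_infty Pup12 < at_infty H12" "at_infty H12 < \<infinity>"
    and KO21: "at_infty Pup21 < at_infty H21" "at_infty H21 < \<infinity>"
    \<comment> \<open>the arguments of the two inverse functions below lie in their domains
        $[0,H_{1,2}(\infty))$ and $[0,H_{2,1}(\infty))$\<close>
    and dom12: "\<And>r. r \<ge> 0 \<Longrightarrow> ereal (kup1 * Pup12 r) < at_infty H12"
    and dom21: "\<And>r. r \<ge> 0 \<Longrightarrow> ereal (kup2 * Pup21 r) < at_infty H21"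
  shows "\<exists>u v. radial_solution TYPE(real ^ 'n) \<phi>1 \<phi>2 a1 a2 f1 f2 u v \<and>
           (\<forall>r\<ge>0. u r > 0 \<and> v r > 0) \<and>
           bounded (u ` {0..}) \<and> bounded (v ` {0..}) \<and>
           u 0 = \<alpha> \<and> v 0 = \<beta> \<and>
           (\<forall>r\<ge>0. \<alpha> + Plo12 r \<le> u r \<and> u r \<le> the_inv_into {\<alpha>..} H12 (kup1 * Pup12 r)) \<and>
           (\<forall>r\<ge>0. \<beta> + Plo21 r \<le> v r \<and> v r \<le> the_inv_into {\<beta>..} H21 (kup2 * Pup21 r))"
proof -
  have dim: "DIM(real ^ 'n) = N" using N(2) by simp
  have f_nn: "0 \<le> f1 s" "0 \<le> f2 s" if "0 < s" for s
    using f that by (simp_all add: cont_nonneg_incr_def cont_nonneg_def)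
  have f1_pos: "0 < f1 s" and f2_pos: "0 < f2 s" if "0 < s" for s
  proof -
    have "f1 s \<noteq> 0" "f2 s \<noteq> 0" using f_pos[OF that that] by auto
    then show "0 < f1 s" "0 < f2 s" using f_nn[OF that] by auto
  qed
  interpret E1: coupled_estimate N \<alpha> \<beta> \<phi>1 \<phi>2 \<theta>lo1 \<theta>up1 \<psi>lo1 \<psi>up1 \<theta>lo2 \<theta>up2 \<psi>lo2 \<psi>up2
      klo1 kup1 klo2 kup2 a1 a2 f1 f2 g1 \<xi>up1 M1 cup1
    by (rule coupled_estimate.intro)
       (use N(1) in simp, (rule pos phi1 phi2 a f f1_pos f2_pos M1 cup g xi_up f1_up; assumption?)+)
  interpret E2: coupled_estimate N \<beta> \<alpha> \<phi>2 \<phi>1 \<theta>lo2 \<theta>up2 \<psi>lo2 \<psi>up2 \<theta>lo1 \<theta>up1 \<psi>lo1 \<psi>up1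
      klo2 kup2 klo1 kup1 a2 a1 f2 f1 g2 \<xi>up2 M2 cup2
    by (rule coupled_estimate.intro)
       (use N(1) in simp, (rule pos phi1 phi2 a f f1_pos f2_pos M2 cup g xi_up f2_up; assumption?)+)
  note defs = Aup1_def Aup2_def Pup12_def Pup21_def H12_def H21_def
  let ?pair1 = "subsolution_pair N \<alpha> \<beta> \<phi>1 \<phi>2 \<theta>lo1 \<theta>up1 \<psi>lo1 \<psi>up1 \<theta>lo2 \<theta>up2 \<psi>lo2 \<psi>up2
      klo1 kup1 klo2 kup2 a1 a2 f1 f2 g1 \<xi>up1 M1 cup1"
  let ?pair2 = "subsolution_pair N \<beta> \<alpha> \<phi>2 \<phi>1 \<theta>lo2 \<theta>up2 \<psi>lo2 \<psi>up2 \<theta>lo1 \<theta>up1 \<psi>lo1 \<psi>up1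
      klo2 kup2 klo1 kup1 a2 a1 f2 f1 g2 \<xi>up2 M2 cup2"
  have pair1: "?pair1 u v" if "incr_from \<alpha> u" "incr_from \<beta> v" "u = E1.T1 v" "\<And>t. 0 \<le> t \<Longrightarrow> v t \<le> E1.T2 u t" for u v
    by (intro subsolution_pair.intro subsolution_pair_axioms.intro E1.coupled_estimate_axioms that)
  have pair2: "?pair2 v u" if "incr_from \<alpha> u" "incr_from \<beta> v" "v = E2.T1 u" "\<And>t. 0 \<le> t \<Longrightarrow> u t \<le> E2.T2 v t" for u v
    by (intro subsolution_pair.intro subsolution_pair_axioms.intro E2.coupled_estimate_axioms that)
  have up1: "u r \<le> the_inv_into {\<alpha>..} H12 (kup1 * Pup12 r)" if "?pair1 u v" "0 \<le> r" for u v r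
    using subsolution_pair.upper_bound[OF that] dom12[OF that(2)] unfolding defs by simp
  have up2: "v r \<le> the_inv_into {\<beta>..} H21 (kup2 * Pup21 r)" if "?pair2 v u" "0 \<le> r" for u v r
    using subsolution_pair.upper_bound[OF that] dom21[OF that(2)] unfolding defs by simp
  obtain u v where u: "incr_from \<alpha> u" and v: "incr_from \<beta> v"
    and u_eq: "u = E1.T1 v" and v_eq: "v = E1.T2 u"
  proof (rule coupled_solution_exists[OF E1.N E1.gauge1 E1.gauge2 a f pos])
    fix u v r assume "incr_from \<alpha> u" "incr_from \<beta> v" "u = E1.T1 v"
      "\<And>t. 0 \<le> t \<Longrightarrow> v t \<le> E1.T2 u t" and r: "(0::real) \<le> r"
    then have "?pair1 u v" by (intro pair1)
    then show "u r \<le> the_inv_into {\<alpha>..} H12 (kup1 * Pup12 r)" using r by (rule up1)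
  next
    fix u v r assume "incr_from \<alpha> u" "incr_from \<beta> v" "v = E1.T2 u"
      "\<And>t. 0 \<le> t \<Longrightarrow> u t \<le> E1.T1 v t" and r: "(0::real) \<le> r"
    then have "?pair2 v u" by (intro pair2)
    then show "v r \<le> the_inv_into {\<beta>..} H21 (kup2 * Pup21 r)" using r by (rule up2)
  qed
  have P1: "?pair1 u v" by (rule pair1[OF u v u_eq]) (simp flip: v_eq)
  have P2: "?pair2 v u" by (rule pair2[OF u v v_eq]) (simp flip: u_eq)
  note force1 = subsolution_pair.force1[OF P1] and force2 = subsolution_pair.force1[OF P2]
  have u_prof: "radial_profile N (h_inv \<phi>1) \<alpha> (\<lambda>t. a1 t * f1 (v t)) = u"
    by (subst u_eq) (simp add: forced_profile_def[abs_def])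
  have v_prof: "radial_profile N (h_inv \<phi>2) \<beta> (\<lambda>t. a2 t * f2 (u t)) = v"
    by (subst v_eq) (simp add: forced_profile_def[abs_def])
  have u_ge: "\<alpha> \<le> u r" and v_ge: "\<beta> \<le> v r" if "0 \<le> r" for r
    using u v that by (simp_all add: incr_from_def)
  have "radial_solution TYPE(real ^ 'n) \<phi>1 \<phi>2 a1 a2 f1 f2 u v"
    unfolding radial_solution_def
  proof (intro conjI exI)
    show "phi_laplacian_eq \<phi>1 (\<lambda>x::real^'n. u (norm x)) (\<lambda>x. a1 (norm x) * f1 (v (norm x)))"
      using phi_laplacian_radial_profile[OF phi1 force1, where 'a = "real ^ 'n" and \<gamma> = \<alpha>]
      unfolding dim u_prof .
    show "phi_laplacian_eq \<phi>2 (\<lambda>x::real^'n. v (norm x)) (\<lambda>x. a2 (norm x) * f2 (u (norm x)))"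
      using phi_laplacian_radial_profile[OF phi2 force2, where 'a = "real ^ 'n" and \<gamma> = \<beta>]
      unfolding dim v_prof .
    show "C1_halfline u (\<lambda>r. h_inv \<phi>1 (radial_avg N (\<lambda>t. a1 t * f1 (v t)) r))"
      using C1_halfline_radial_profile[OF E1.N E1.gauge1 force1, of \<alpha>] unfolding u_prof .
    show "C1_halfline v (\<lambda>r. h_inv \<phi>2 (radial_avg N (\<lambda>t. a2 t * f2 (u t)) r))"
      using C1_halfline_radial_profile[OF E1.N E1.gauge2 force2, of \<beta>] unfolding v_prof .
    show "radial_eq DIM(real ^ 'n) \<phi>1 (\<lambda>r. h_inv \<phi>1 (radial_avg N (\<lambda>t. a1 t * f1 (v t)) r)) (\<lambda>r. a1 r * f1 (v r))"
      unfolding dim by (rule radial_eq_radial_profile[OF phi1 E1.N force1])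
    show "radial_eq DIM(real ^ 'n) \<phi>2 (\<lambda>r. h_inv \<phi>2 (radial_avg N (\<lambda>t. a2 t * f2 (u t)) r)) (\<lambda>r. a2 r * f2 (u r))"
      unfolding dim by (rule radial_eq_radial_profile[OF phi2 E1.N force2])
  qed (simp_all add: h_inv_def)
  moreover have "bounded (u ` {0..})" "bounded (v ` {0..})"
  proof -
    obtain C1 where C1: "\<forall>r\<ge>0. u r \<le> C1"
      using subsolution_pair.bounded_above[OF P1] KO12(2) dom12 unfolding defs by blast
    obtain C2 where C2: "\<forall>r\<ge>0. v r \<le> C2"
      using subsolution_pair.bounded_above[OF P2] KO21(2) dom21 unfolding defs by blast
    have "u ` {0..} \<subseteq> {\<alpha>..C1}" "v ` {0..} \<subseteq> {\<beta>..C2}"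
      using u_ge v_ge C1 C2 by auto
    then show "bounded (u ` {0..})" "bounded (v ` {0..})"
      using bounded_subset bounded_closed_interval by metis+
  qed
  moreover have "\<alpha> + Plo12 r \<le> u r" if "0 \<le> r" for r
    unfolding Plo12_def Alo2_def
    by (rule component_lower_bound[OF E1.N E1.gauge1 phi2 a f f2_pos[OF pos(1)] pos clo(1) xi_lo(1)
          _ _ _ f1_lo u u_eq v v_eq that]) (use m1 in auto)
  moreover have "\<beta> + Plo21 r \<le> v r" if "0 \<le> r" for r
    unfolding Plo21_def Alo1_def
    by (rule component_lower_bound[OF E1.N E1.gauge2 phi1 a(2,1) f(2,1) f1_pos[OF pos(2)] pos(2,1) clo(2) xi_lo(2)
          _ _ _ f2_lo v v_eq u u_eq that]) (use m2 in auto)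
  moreover have "u 0 = \<alpha>" "v 0 = \<beta>"
    by (rule subsolution_pair.u_0[OF P1], rule subsolution_pair.u_0[OF P2])
  moreover have "0 < u r \<and> 0 < v r" if "0 \<le> r" for r
    using u_ge[OF that] v_ge[OF that] pos by linarith
  ultimately show ?thesis using up1[OF P1] up2[OF P2] by blast
qed

end
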